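(* Let $p\equiv1\pmod6$ be a prime of the form $p=a^2+a+1$ with $a\in\mathbb Z$, and let $H$ be the subgroup of order $3$ of $(\mathbb Z/p\mathbb Z)^*$. Then $$M_2(p,H)=\frac{\pi^2}{8}\left(1-(-1)^a\frac{2a+1}{p}\right)\quad\text{and}\quad M_6(p,H)=\frac{\pi^2}{9}\left(1+\frac{c_a}{p}\right),$$ where $c_a=-2a-1$ if $a\equiv0\pmod6$, $c_a=-3$ if $a\equiv2$ or $3\pmod6$, and $c_a=2a+1$ if $a\equiv5\pmod6$ (these are the only possible residues of $a$ modulo $6$ here).
   Context: $X_p^-(H)$ is the set of Dirichlet characters $\chi$ mod $p$ with $\chi(-1)=-1$ and $\chi|_H=1$; for $d_0\in\{2,6\}$, $M_{d_0}(p,H)=\frac{1}{\#X_p^-(H)}\sum_{\chi\in X_p^-(H)}|L(1,\chi')|^2$, where $\chi'$ is the character modulo $d_0p$ induced by $\chi$ and $L(1,\chi')=\sum_{n\ge1}\chi'(n)/n$. *)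

theory Defs
  imports Complex_Main "HOL-Number_Theory.Residues"
begin

definition dirichlet_character :: "nat \<Rightarrow> (int \<Rightarrow> complex) \<Rightarrow> bool" where
  "dirichlet_character m \<chi> \<longleftrightarrow>
     (\<forall>k l. \<chi> (k * l) = \<chi> k * \<chi> l) \<and>
     (\<forall>k. \<chi> (k + int m) = \<chi> k) \<and>
     (\<forall>k. \<chi> k \<noteq> 0 \<longleftrightarrow> coprime k (int m))"

(* H is a set of integer representatives in {0..<p}, as in the unit group of
   residue_ring (int p). *)
definition odd_chars_trivial_on :: "nat \<Rightarrow> int set \<Rightarrow> (int \<Rightarrow> complex) set" where
  "odd_chars_trivial_on p H =
     {\<chi>. dirichlet_character p \<chi> \<and> \<chi> (- 1) = - 1 \<and> (\<forall>h\<in>H. \<chi> h = 1)}"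

(* Meant for m a multiple of the modulus of \<chi>. *)
definition induced_character :: "nat \<Rightarrow> (int \<Rightarrow> complex) \<Rightarrow> int \<Rightarrow> complex" where
  "induced_character m \<chi> k = (if coprime k (int m) then \<chi> k else 0)"

(* The series converges only conditionally for a nonprincipal character, so it is
   the limit of its partial sums in the usual order; the index is shifted so that
   the sum runs over n >= 1. *)
definition L_at_1 :: "(int \<Rightarrow> complex) \<Rightarrow> complex" where
  "L_at_1 \<chi> = (\<Sum>n. \<chi> (int (Suc n)) / of_nat (Suc n))"

definition mean_square_L :: "nat \<Rightarrow> nat \<Rightarrow> int set \<Rightarrow> real" where
  "mean_square_L d\<^sub>0 p H =
     1 / real (card (odd_chars_trivial_on p H)) *
     (\<Sum>\<chi>\<in>odd_chars_trivial_on p H. (cmod (L_at_1 (induced_character (d\<^sub>0 * p) \<chi>)))\<^sup>2)"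

(* Only the residues 0, 2, 3, 5 of a modulo 6 are meaningful. *)
definition c_coeff :: "int \<Rightarrow> int" where
  "c_coeff a =
     (if a mod 6 = 0 then - 2 * a - 1
      else if a mod 6 = 2 \<or> a mod 6 = 3 then - 3
      else if a mod 6 = 5 then 2 * a + 1
      else undefined)"

end

theory Submission
  imports Defs "HOL-Analysis.Analysis" "HOL-Number_Theory.Number_Theory"
begin

text \<open>
  Orthogonality of the odd characters trivial on \<open>H = {1, a, a\<^sup>2}\<close> turns the average of
  \<open>\<psi>(c) |L(1,\<psi>)|\<^sup>2\<close> into \<open>2\<pi>\<^sup>2/p\<close> times the sum of the Dedekind sums \<open>s(hc, p)\<close> over \<open>h \<in> H\<close>,
  because \<open>L(1,\<psi>)\<close> is a combination of the values \<open>cot (\<pi>k/p)\<close>, whose discrete Fourier transform is the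
  sawtooth function. The Euler factors at 2 and 3 expand \<open>M\<^sub>2\<close> into the averages with \<open>c = 1, 2\<close> and
  \<open>M\<^sub>6\<close> into those with \<open>c = 1, 2, 3, 6\<close> and \<open>c \<equiv> 2/3\<close>. As \<open>p = a\<^sup>2 + a + 1\<close>, a few steps of the
  Euclidean algorithm and Dedekind's reciprocity law evaluate all these sums. The substitution
  \<open>a \<mapsto> - 1 - a\<close> fixes \<open>p\<close> and \<open>H\<close> and changes the parity of \<open>a\<close>, so \<open>a\<close> may be taken even.
\<close>

text \<open>The weights \<open>c\<close> come from
  \<open>|1 - \<psi>(q)/q|^2 = 1 + 1/q^2 - (2/q) Re \<psi>(q)\<close>. The class 2/3 enters because
  \<open>Re \<psi>(2) * Re \<psi>(3)\<close> is the mean of \<open>Re \<psi>(6)\<close> and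
  \<open>Re (\<psi>(2) * cnj \<psi>(3))\<close>. The constant 2 pi^2/p is (pi/(2p))^2 from two
  closed forms of L(1,psi), times 4p from the Fourier transform of the sawtooth, times 2 because
  orthogonality selects both H and -H. The L-series converge only conditionally. Hence they are
  summed in blocks of length p, where oddness cancels the logarithmic growth and leaves digamma
  values, and Euler factors are split off by order-preserving reindexing only. Since
  \<open>a\<close> may be negative, the Euclidean chains pass through numbers of either sign, so
  reciprocity is needed for all signs. One chain serves every \<open>c\<close> that divides
  \<open>a\<close>: exactly one of \<open>a\<close> and \<open>- 1 - a\<close> is even, and one of
  them is divisible by 3 because p is 1 modulo 6. The class 2/3, and also 6 when \<open>a\<close> is
  2 modulo 6, need chains of their own.\<close>

lemmas cong_iff_mod_eq = unique_euclidean_semiring_class.cong_def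

section \<open>Dedekind sums\<close>

lemma sum_residues_mult:
  fixes F :: "int \<Rightarrow> 'a::comm_monoid_add"
  assumes "k > 0" "coprime c k" and per: "\<And>i. F (i mod k) = F i"
  shows "(\<Sum>i\<in>{0..<k}. F (c * i)) = (\<Sum>i\<in>{0..<k}. F i)"
proof -
  have inj: "inj_on (\<lambda>i. c * i mod k) {0..<k}"
  proof (rule inj_onI)
    fix x y assume xy: "x \<in> {0..<k}" "y \<in> {0..<k}" "c * x mod k = c * y mod k"
    then have "[c * x = c * y] (mod k)" by (simp add: cong_iff_mod_eq)
    then have "[x = y] (mod k)"
      using cong_mult_lcancel[OF assms(2)] by simp
    with xy show "x = y" by (auto simp: cong_iff_mod_eq)
  qed
  have "(\<lambda>i. c * i mod k) ` {0..<k} = {0..<k}"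
    by (rule endo_inj_surj) (use inj \<open>k > 0\<close> in auto)
  with inj have "bij_betw (\<lambda>i. c * i mod k) {0..<k} {0..<k}"
    by (simp add: bij_betw_def)
  from sum.reindex_bij_betw[OF this, of F] show ?thesis
    by (simp add: per)
qed

lemma sum_residues_add:
  fixes F :: "int \<Rightarrow> 'a::comm_monoid_add"
  assumes "k > 0" and per: "\<And>i. F (i mod k) = F i"
  shows "(\<Sum>i\<in>{0..<k}. F (i + c)) = (\<Sum>i\<in>{0..<k}. F i)"
proof -
  have inj: "inj_on (\<lambda>i. (i + c) mod k) {0..<k}"
  proof (rule inj_onI)
    fix x y assume xy: "x \<in> {0..<k}" "y \<in> {0..<k}" "(x + c) mod k = (y + c) mod k"
    then have "[x + c = y + c] (mod k)" by (simp add: cong_iff_mod_eq)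
    then have "[x = y] (mod k)"
      by (simp add: cong_add_rcancel)
    with xy show "x = y" by (auto simp: cong_iff_mod_eq)
  qed
  have "(\<lambda>i. (i + c) mod k) ` {0..<k} = {0..<k}"
    by (rule endo_inj_surj) (use inj \<open>k > 0\<close> in auto)
  with inj have "bij_betw (\<lambda>i. (i + c) mod k) {0..<k} {0..<k}"
    by (simp add: bij_betw_def)
  from sum.reindex_bij_betw[OF this, of F] show ?thesis
    by (simp add: per)
qed

text \<open>This is the sawtooth function at \<open>i / k\<close>. For \<open>k < 0\<close> it is so
  as well, because \<open>i mod k\<close> then lies in the interval from \<open>k + 1\<close> to
  0.\<close>

definition saw :: "int \<Rightarrow> int \<Rightarrow> real" where
  "saw k i = (if k dvd i then 0 else of_int (i mod k) / of_int k - 1 / 2)"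

text \<open>The factor \<open>sgn k\<close> makes the sum odd in both arguments, so that reciprocity holds for
  arguments of either sign.\<close>

definition dedekind_sum :: "int \<Rightarrow> int \<Rightarrow> real" where
  "dedekind_sum h k = of_int (sgn k) * (\<Sum>i\<in>{0..<\<bar>k\<bar>}. saw k i * saw k (h * i))"

lemma saw_mod [simp]: "saw k (i mod k) = saw k i"
  by (simp add: saw_def dvd_mod_iff)

lemma saw_minus:
  assumes "k \<noteq> 0"
  shows "saw k (- i) = - saw k i"
proof (cases "k dvd i")
  case False
  then have "(- i) mod k = k - i mod k"
    by (subst zmod_zminus1_eq_if) auto
  then have "real_of_int ((- i) mod k) = of_int k - of_int (i mod k)" by simp
  with False assms show ?thesis by (simp add: saw_def diff_divide_distrib)
qed (auto simp: saw_def)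

lemma saw_minus_left:
  assumes "k \<noteq> 0"
  shows "saw (- k) i = - saw k i"
proof (cases "k dvd i")
  case False
  then have "i mod (- k) = i mod k - k"
    by (subst zmod_zminus2_eq_if) auto
  then have "real_of_int (i mod (- k)) = of_int (i mod k) - of_int k" by simp
  with False assms show ?thesis by (simp add: saw_def diff_divide_distrib)
qed (auto simp: saw_def)

lemma dedekind_sum_minus: "dedekind_sum (- h) k = - dedekind_sum h k"
  by (cases "k = 0") (simp_all add: dedekind_sum_def saw_minus sum_negf)

lemma dedekind_sum_minus_right: "dedekind_sum h (- k) = - dedekind_sum h k"
  by (cases "k = 0") (simp_all add: dedekind_sum_def saw_minus_left)

lemma dedekind_sum_cong: "[h = h'] (mod k) \<Longrightarrow> dedekind_sum h k = dedekind_sum h' k"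
proof -
  assume "[h = h'] (mod k)"
  then have "saw k (h * i) = saw k (h' * i)" for i
    using cong_scalar_right[of h h' k i] saw_mod[of k "h * i"] saw_mod[of k "h' * i"]
    by (simp add: cong_iff_mod_eq)
  then show ?thesis by (simp add: dedekind_sum_def)
qed

section \<open>Dedekind's reciprocity law\<close>

lemma sum_ints: "k \<ge> 0 \<Longrightarrow> 2 * (\<Sum>i\<in>{0..<k}. i) = k * (k - 1 :: int)"
proof (induction k rule: int_ge_induct)
  case (step k)
  then have "{0..<k + 1} = insert k {0..<k}" by auto
  with step show ?case by (simp add: algebra_simps)
qed simp

lemma sum_int_squares: "k \<ge> 0 \<Longrightarrow> 6 * (\<Sum>i\<in>{0..<k}. i\<^sup>2) = k * (k - 1) * (2 * k - 1 :: int)"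
proof (induction k rule: int_ge_induct)
  case (step k)
  then have "{0..<k + 1} = insert k {0..<k}" by auto
  with step show ?case by (simp add: algebra_simps power2_eq_square)
qed simp

lemma le_div_iff_int:
  fixes j k n :: int
  assumes "k > 0"
  shows "j \<le> n div k \<longleftrightarrow> k * j \<le> n"
proof
  have n: "n = k * (n div k) + n mod k" "0 \<le> n mod k" "n mod k < k"
    using assms by simp_all
  show "k * j \<le> n" if "j \<le> n div k"
    using mult_left_mono[OF that, of k] n assms by linarith
  show "j \<le> n div k" if "k * j \<le> n"
  proof (rule ccontr)
    assume "\<not> j \<le> n div k"
    then have "k * (n div k + 1) \<le> k * j"
      using assms by (intro mult_left_mono) auto
    then have "k * (n div k) + k \<le> k * j" by (simp add: distrib_left)
    with n that show False by linarith
  qed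
qed

text \<open>Lattice point count: q^2 + q = 2 (1 + ... + q) with q = \<open>h * i div k\<close> makes
  the left side a sum of \<open>2 * j\<close> over the points with \<open>k * j \<le> h * i\<close>.
  Counting the same points for fixed \<open>j\<close> exchanges the roles of \<open>h\<close> and
  \<open>k\<close>.\<close>

lemma sum_floor_squares:
  fixes h k :: int
  assumes "h > 0" "k > 0" "coprime h k"
  shows "(\<Sum>i\<in>{0..<k}. (h * i div k)\<^sup>2) + (\<Sum>i\<in>{0..<k}. h * i div k)
       = (k - 1) * h * (h - 1) - 2 * (\<Sum>j\<in>{0..<h}. j * (k * j div h))"
proof -
  have inner: "(h * i div k)\<^sup>2 + h * i div k = (\<Sum>j\<in>{0..<h}. if k * j \<le> h * i then 2 * j else 0)"
    if i: "i \<in> {0..<k}" for i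
  proof -
    have le: "k * j \<le> h * i \<longleftrightarrow> j \<le> h * i div k" for j
      using assms(2) by (simp add: le_div_iff_int)
    have "h * i div k < h"
      unfolding not_le[symmetric] le[symmetric] using i assms by (simp add: mult.commute)
    have nn: "h * i div k \<ge> 0" using i assms by (simp add: pos_imp_zdiv_nonneg_iff)
    have "(\<Sum>j\<in>{0..<h}. if k * j \<le> h * i then 2 * j else 0) = (\<Sum>j\<in>{0..<h * i div k + 1}. 2 * j)"
      unfolding le using \<open>h * i div k < h\<close>
      by (intro sum.mono_neutral_cong_right) auto
    also have "\<dots> = 2 * (\<Sum>j\<in>{0..<h * i div k + 1}. j)" by (simp add: sum_distrib_left)
    also have "\<dots> = (h * i div k + 1) * (h * i div k + 1 - 1)"
      using nn by (intro sum_ints) auto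
    finally show ?thesis by (simp add: power2_eq_square algebra_simps)
  qed
  have col: "(\<Sum>i\<in>{0..<k}. if k * j \<le> h * i then 2 * j else 0) = 2 * j * (k - 1 - k * j div h)"
    if j: "j \<in> {0..<h}" for j
  proof (cases "j = 0")
    case False
    with j have j: "0 < j" "j < h" by auto
    \<comment> \<open>No lattice point lies on the line \<open>k * j = h * i\<close> for such
      \<open>j\<close>, so the admissible \<open>i\<close> start exactly one above the
      floor.\<close>
    have ndvd: "\<not> h dvd k * j"
      using assms(3) j by (simp add: coprime_dvd_mult_right_iff zdvd_not_zless)
    have nn: "k * j div h \<ge> 0" using j assms by (simp add: pos_imp_zdiv_nonneg_iff)
    have lt: "k * j div h < k"
      unfolding not_le[symmetric] le_div_iff_int[OF assms(1)] using j assms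
      by (simp add: mult.commute)
    have le: "k * j \<le> h * i \<longleftrightarrow> k * j div h + 1 \<le> i" for i
    proof -
      have "k * j \<le> h * i \<longleftrightarrow> k * j < h * i"
        using ndvd by (auto simp: order_le_less)
      also have "\<dots> \<longleftrightarrow> k * j div h < i"
        unfolding not_le[symmetric] le_div_iff_int[OF assms(1)] ..
      finally show ?thesis by auto
    qed
    have "(\<Sum>i\<in>{0..<k}. if k * j \<le> h * i then 2 * j else 0) = (\<Sum>i\<in>{k * j div h + 1..<k}. 2 * j)"
      unfolding le using nn by (intro sum.mono_neutral_cong_right) auto
    also have "\<dots> = 2 * j * (k - 1 - k * j div h)"
      using lt by (simp add: nat_diff_distrib of_nat_nat algebra_simps)
    finally show ?thesis .
  qed (simp add: sum.neutral)
  have "(\<Sum>i\<in>{0..<k}. (h * i div k)\<^sup>2) + (\<Sum>i\<in>{0..<k}. h * i div k)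
      = (\<Sum>i\<in>{0..<k}. \<Sum>j\<in>{0..<h}. if k * j \<le> h * i then 2 * j else 0)"
    by (simp add: sum.distrib[symmetric] inner)
  also have "\<dots> = (\<Sum>j\<in>{0..<h}. \<Sum>i\<in>{0..<k}. if k * j \<le> h * i then 2 * j else 0)"
    by (rule sum.swap)
  also have "\<dots> = (\<Sum>j\<in>{0..<h}. 2 * j * (k - 1 - k * j div h))"
    by (simp add: col)
  also have "\<dots> = (k - 1) * (2 * (\<Sum>j\<in>{0..<h}. j)) - 2 * (\<Sum>j\<in>{0..<h}. j * (k * j div h))"
    by (simp add: algebra_simps sum_subtractf sum_distrib_left sum.distrib)
  also have "2 * (\<Sum>j\<in>{0..<h}. j) = h * (h - 1)"
    using assms by (intro sum_ints) auto
  finally show ?thesis by (simp add: algebra_simps)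
qed

text \<open>Replacing \<open>h * i mod k\<close> by \<open>h * i - k * (h * i div k)\<close> leaves
  \<open>F\<close> as the only quantity without a closed form.\<close>

lemma dedekind_sum_conv_floor:
  fixes h k :: int
  assumes "k > 0" "coprime h k"
  defines "A \<equiv> \<Sum>i\<in>{0..<k}. i\<^sup>2" and "F \<equiv> \<Sum>i\<in>{0..<k}. i * (h * i div k)"
  shows "dedekind_sum h k = (h * A - k * F) / (of_int k)\<^sup>2 - (k - 1) / 4"
proof -
  define K where "K = real_of_int k"
  have K: "K > 0" using assms by (simp add: K_def)
  have dvd: "k dvd h * i \<longleftrightarrow> k dvd i" for i
    using assms(2) by (simp add: coprime_commute coprime_dvd_mult_right_iff)
  have sum1: "(\<Sum>i\<in>{0..<k}. real_of_int i) = K * (K - 1) / 2"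
  proof -
    have "2 * (\<Sum>i\<in>{0..<k}. real_of_int i) = of_int (2 * (\<Sum>i\<in>{0..<k}. i))" by simp
    also have "\<dots> = of_int (k * (k - 1))" using assms(1) by (subst sum_ints) auto
    finally show ?thesis by (simp add: K_def)
  qed
  have sumr: "(\<Sum>i\<in>{0..<k}. real_of_int (h * i mod k)) = K * (K - 1) / 2"
    using sum_residues_mult[of k h "\<lambda>i. real_of_int (i mod k)"] assms sum1 by simp
  \<comment> \<open>The linear expressions are wrong only at \<open>i = 0\<close>, where the
    sawtooth is 0 but they would contribute (-1/2)^2 = 1/4.\<close>
  have "dedekind_sum h k = (\<Sum>i\<in>{0..<k}. (of_int i / K - 1 / 2) * (of_int (h * i mod k) / K - 1 / 2)
      - (if i = 0 then 1 / 4 else 0))"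
  proof -
    have "dedekind_sum h k = (\<Sum>i\<in>{0..<k}. saw k i * saw k (h * i))"
      using assms(1) by (simp add: dedekind_sum_def)
    also have "\<dots> = (\<Sum>i\<in>{0..<k}. (of_int i / K - 1 / 2) * (of_int (h * i mod k) / K - 1 / 2)
        - (if i = 0 then 1 / 4 else 0))"
      by (intro sum.cong refl) (auto simp: saw_def dvd K_def zdvd_not_zless)
    finally show ?thesis .
  qed
  also have "\<dots> = (\<Sum>i\<in>{0..<k}. (of_int i / K - 1 / 2) * (of_int (h * i mod k) / K - 1 / 2)) - 1 / 4"
    using assms(1) by (simp add: sum_subtractf)
  also have "(\<Sum>i\<in>{0..<k}. (of_int i / K - 1 / 2) * (of_int (h * i mod k) / K - 1 / 2))
     = (\<Sum>i\<in>{0..<k}. of_int (i * (h * i mod k)) / K\<^sup>2 - of_int i / (2 * K) - of_int (h * i mod k) / (2 * K) + 1 / 4)"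
    using K by (intro sum.cong) (auto simp: field_simps power2_eq_square)
  also have "\<dots> = of_int (\<Sum>i\<in>{0..<k}. i * (h * i mod k)) / K\<^sup>2 - (K - 1) / 4 - (K - 1) / 4 + K / 4"
    using K assms(1) by (simp add: sum.distrib sum_subtractf sum_divide_distrib[symmetric] sum1 sumr K_def[symmetric] del: of_int_mult)
  also have "(\<Sum>i\<in>{0..<k}. i * (h * i mod k)) = h * A - k * F"
    unfolding A_def F_def sum_distrib_left sum_subtractf[symmetric]
    by (intro sum.cong refl) (simp add: minus_mult_div_eq_mod[symmetric] algebra_simps power2_eq_square)
  finally show ?thesis unfolding K_def by simp argo
qed

text \<open>The residues \<open>h * i mod k\<close> permute 0, ..., k - 1, so their squares sum to
  \<open>A\<close>. Expanding these squares ties \<open>F\<close> to \<open>F2\<close>, and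
  \<open>sum_floor_squares\<close> trades \<open>F2\<close> for \<open>G\<close>. This determines
  \<open>h * F + k * G\<close>, the very combination that the two Dedekind sums contain over the
  common denominator.\<close>

lemma dedekind_reciprocity_pos:
  fixes h k :: int
  assumes "h > 0" "k > 0" "coprime h k"
  shows "dedekind_sum h k + dedekind_sum k h
           = - 1 / 4 + ((of_int h)\<^sup>2 + (of_int k)\<^sup>2 + 1) / (12 * of_int h * of_int k)"
proof -
  define A where "A = (\<Sum>i\<in>{0..<k}. i\<^sup>2)"
  define B where "B = (\<Sum>i\<in>{0..<h}. i\<^sup>2)"
  define F where "F = (\<Sum>i\<in>{0..<k}. i * (h * i div k))"
  define G where "G = (\<Sum>i\<in>{0..<h}. i * (k * i div h))"
  define F0 where "F0 = (\<Sum>i\<in>{0..<k}. h * i div k)"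
  define F2 where "F2 = (\<Sum>i\<in>{0..<k}. (h * i div k)\<^sup>2)"
  have A: "6 * A = k * (k - 1) * (2 * k - 1)" and B: "6 * B = h * (h - 1) * (2 * h - 1)"
    unfolding A_def B_def using assms by (auto intro!: sum_int_squares)
  have r: "h * i mod k = h * i - k * (h * i div k)" for i
    by (simp add: minus_mult_div_eq_mod)
  have "(\<Sum>i\<in>{0..<k}. h * i mod k) = (\<Sum>i\<in>{0..<k}. i)"
    using sum_residues_mult[of k h "\<lambda>i. i mod k"] assms by simp
  then have "h * (\<Sum>i\<in>{0..<k}. i) - k * F0 = (\<Sum>i\<in>{0..<k}. i)"
    by (simp add: r F0_def sum_subtractf sum_distrib_left)
  moreover have "2 * (\<Sum>i\<in>{0..<k}. i) = k * (k - 1)"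
    using assms by (intro sum_ints) auto
  moreover have "k * (2 * F0) = (h - 1) * (2 * (\<Sum>i\<in>{0..<k}. i))"
    using calculation(1) by (simp add: algebra_simps)
  ultimately have "k * (2 * F0) = k * ((h - 1) * (k - 1))"
    by simp
  then have F0: "2 * F0 = (h - 1) * (k - 1)" using assms by simp
  have "(\<Sum>i\<in>{0..<k}. (h * i mod k)\<^sup>2) = A"
    using sum_residues_mult[of k h "\<lambda>i. (i mod k)\<^sup>2"] assms by (simp add: A_def)
  moreover have "(\<Sum>i\<in>{0..<k}. (h * i mod k)\<^sup>2) = h\<^sup>2 * A - 2 * h * k * F + k\<^sup>2 * F2"
    unfolding A_def F_def F2_def r sum_distrib_left sum_subtractf[symmetric] sum.distrib[symmetric]
    by (intro sum.cong refl) (simp add: algebra_simps power2_eq_square)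
  ultimately have main: "h\<^sup>2 * A - 2 * h * k * F + k\<^sup>2 * F2 = A" by simp
  have F2: "F2 + F0 = (k - 1) * h * (h - 1) - 2 * G"
    unfolding F2_def F0_def G_def by (rule sum_floor_squares) fact+
  define Q where "Q = (h\<^sup>2 - 1) * (k - 1) * (2 * k - 1) + 6 * k * (k - 1) * h * (h - 1) - 3 * k * (h - 1) * (k - 1)"
  \<comment> \<open>The factor \<open>k\<close> makes the term \<open>k\<^sup>2 * F2\<close> of
    \<open>main\<close> appear; it is cancelled again once the right side is seen to be a multiple
    of \<open>k\<close>.\<close>
  have "k * (12 * (h * F + k * G)) = 6 * ((h\<^sup>2 - 1) * A + k\<^sup>2 * ((k - 1) * h * (h - 1) - F0))"
  proof -
    have F2': "F2 = (k - 1) * h * (h - 1) - 2 * G - F0" using F2 by simp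
    show ?thesis using main unfolding F2' by (simp add: algebra_simps power2_eq_square)
  qed
  also have "\<dots> = (h\<^sup>2 - 1) * (6 * A) + 3 * k\<^sup>2 * (2 * ((k - 1) * h * (h - 1)) - 2 * F0)"
    by (simp add: algebra_simps)
  also have "\<dots> = k * Q"
    unfolding A F0 Q_def by (simp add: algebra_simps power2_eq_square)
  finally have *: "12 * (h * F + k * G) = Q" using assms by simp
  define x y f g where "x = real_of_int h" and "y = real_of_int k" and "f = real_of_int F" and "g = real_of_int G"
  have xy: "x > 0" "y > 0" using assms by (auto simp: x_def y_def)
  have r1: "real_of_int A = y * (y - 1) * (2 * y - 1) / 6"
    using arg_cong[OF A, of real_of_int] by (simp add: y_def)
  have r2: "real_of_int B = x * (x - 1) * (2 * x - 1) / 6"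
    using arg_cong[OF B, of real_of_int] by (simp add: x_def)
  have r3: "x * f + y * g =
      ((x\<^sup>2 - 1) * (y - 1) * (2 * y - 1) + 6 * y * (y - 1) * x * (x - 1) - 3 * y * (x - 1) * (y - 1)) / 12"
    using arg_cong[OF *, of real_of_int] unfolding x_def y_def f_def g_def Q_def by simp
  have "dedekind_sum h k + dedekind_sum k h =
     (x * A - y * f) / y\<^sup>2 - (y - 1) / 4 + ((y * B - x * g) / x\<^sup>2 - (x - 1) / 4)"
    using dedekind_sum_conv_floor[of k h] dedekind_sum_conv_floor[of h k] assms
    by (simp add: A_def B_def F_def G_def x_def y_def f_def g_def coprime_commute)
  also have "\<dots> = (x\<^sup>2 * (x * A) + y\<^sup>2 * (y * B) - x * y * (x * f + y * g)) / (x\<^sup>2 * y\<^sup>2) - (y - 1) / 4 - (x - 1) / 4"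
    using xy by (simp add: field_simps power2_eq_square)
  also have "\<dots> = - 1 / 4 + (x\<^sup>2 + y\<^sup>2 + 1) / (12 * x * y)"
    unfolding r1 r2 r3 using xy by (simp add: field_simps power2_eq_square)
  finally show ?thesis by (simp add: x_def y_def)
qed

lemma dedekind_sum_0_left [simp]: "dedekind_sum 0 k = 0"
  by (simp add: dedekind_sum_def saw_def)

text \<open>Changing the sign of one argument changes the sign of every term on both sides, which
  reduces all cases to positive arguments.\<close>

lemma dedekind_reciprocity:
  fixes h k :: int
  assumes "h \<noteq> 0" "k \<noteq> 0" "coprime h k"
  shows "dedekind_sum h k + dedekind_sum k h
           = - of_int (sgn (h * k)) / 4 + ((of_int h)\<^sup>2 + (of_int k)\<^sup>2 + 1) / (12 * of_int h * of_int k)"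
proof -
  have pos: "dedekind_sum h k + dedekind_sum k h
           = - of_int (sgn (h * k)) / 4 + ((of_int h)\<^sup>2 + (of_int k)\<^sup>2 + 1) / (12 * of_int h * of_int k)"
    if "h > 0" "k \<noteq> 0" "coprime h k" for h k :: int
  proof (cases "k > 0")
    case True
    with that show ?thesis using dedekind_reciprocity_pos[of h k] by simp
  next
    case False
    with that have "dedekind_sum h (- k) + dedekind_sum (- k) h
       = - 1 / 4 + ((of_int h)\<^sup>2 + (of_int (- k))\<^sup>2 + 1) / (12 * of_int h * of_int (- k))"
      by (intro dedekind_reciprocity_pos) auto
    moreover have "sgn (h * k) = - 1" using False that by (simp add: sgn_mult)
    ultimately show ?thesis by (simp add: dedekind_sum_minus dedekind_sum_minus_right)
  qed
  show ?thesis
  proof (cases "h > 0")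
    case False
    then show ?thesis
      using pos[of "- h" "- k"] assms by (simp add: dedekind_sum_minus dedekind_sum_minus_right)
  qed (use pos assms in auto)
qed

section \<open>Euclidean evaluation of the sums over the cubic subgroup\<close>

definition reciprocity_term :: "int \<Rightarrow> int \<Rightarrow> real" where
  "reciprocity_term h k =
     (((of_int h)\<^sup>2 + (of_int k)\<^sup>2 + 1) / (of_int h * of_int k) - 3 * of_int (sgn h * sgn k)) / 12"

lemma reciprocity_term_times_12:
  "12 * reciprocity_term h k =
     ((of_int h)\<^sup>2 + (of_int k)\<^sup>2 + 1) / (of_int h * of_int k) - 3 * of_int (sgn h * sgn k)"
  by (simp add: reciprocity_term_def)

text \<open>One step of the Euclidean algorithm: reciprocity exchanges the arguments and periodicity
  reduces \<open>k\<close> to \<open>r\<close>. The remainder may have any sign or size, and the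
  coprimality is returned for use in the preceding step of a chain.\<close>

lemma dedekind_sum_step:
  fixes h k q r :: int
  assumes "k = q * h + r" "coprime r h" "h \<noteq> 0" "k \<noteq> 0"
  shows "coprime h k" and "dedekind_sum h k = reciprocity_term h k - dedekind_sum r h"
proof -
  show "coprime h k"
    using assms(2) gcd_add_mult[of h q r] unfolding assms(1) coprime_iff_gcd_eq_1
    by (simp add: gcd.commute add.commute)
  moreover have "dedekind_sum k h = dedekind_sum r h"
    by (rule dedekind_sum_cong) (simp add: assms(1) cong_iff_mod_eq)
  ultimately show "dedekind_sum h k = reciprocity_term h k - dedekind_sum r h"
    using dedekind_reciprocity[of h k] assms(3,4)
    by (simp add: reciprocity_term_def sgn_mult diff_divide_distrib mult_ac)
qed

lemma dedekind_sum_1_left: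
  "k \<noteq> 0 \<Longrightarrow> dedekind_sum 1 k = reciprocity_term 1 k"
  using dedekind_sum_step(2)[of k k 1 0] by simp

text \<open>The sum over the order 3 subgroup \<open>{1, a, a\<^sup>2}\<close> modulo \<open>p = a\<^sup>2 + a + 1\<close>, with \<open>a\<^sup>2\<close> replaced by \<open>- (a + 1)\<close>.\<close>

definition dedekind_sum3 :: "int \<Rightarrow> int \<Rightarrow> int \<Rightarrow> real" where
  "dedekind_sum3 a c p = dedekind_sum c p + dedekind_sum (c * a) p - dedekind_sum (c * (a + 1)) p"

lemma coprime_mult_add_1: "coprime (m * n + 1 :: int) n" "coprime n (m * n + 1 :: int)"
  using gcd_add_mult[of n m 1] by (simp_all add: coprime_iff_gcd_eq_1 gcd.commute add.commute)

text \<open>If \<open>c\<close> divides \<open>a\<close>, then \<open>p\<close> is 1 modulo both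
  \<open>c\<close> and \<open>c * (a + 1)\<close>, and the chain of \<open>c * a\<close> ends after
  a few steps. All denominators except \<open>c\<close> cancel in the total.\<close>

lemma dedekind_sum3_multiple:
  fixes a b c p :: int
  assumes a: "a = b * c" and "c > 0" "b \<noteq> 0" "a \<noteq> - 1" and p: "p = a\<^sup>2 + a + 1"
  shows "12 * dedekind_sum3 a c p = of_int a * (of_int a + (of_int c)\<^sup>2) / of_int c"
proof -
  have "4 * p = (2 * a + 1)\<^sup>2 + 3" unfolding p by (simp add: power2_eq_square algebra_simps)
  then have "p > 0" using zero_le_power2[of "2 * a + 1"] by linarith
  \<comment> \<open>As \<open>a\<close> is neither 0 nor -1, the numbers \<open>b\<close>,
    \<open>a\<close> and \<open>a + 1\<close> share this sign, so both signs of \<open>a\<close> can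
    be treated together.\<close>
  define s where "s = sgn b"
  have s: "sgn a = s" "sgn (a + 1) = s" "s = 1 \<or> s = - 1" and nz: "a \<noteq> 0" "a + 1 \<noteq> 0"
  proof -
    consider "b > 0" "a > 0" | "b < 0" "a < 0"
      using mult_pos_pos[of b c] mult_neg_pos[of b c] assms(1-3) by linarith
    then show "sgn a = s" "sgn (a + 1) = s" "s = 1 \<or> s = - 1" "a \<noteq> 0" "a + 1 \<noteq> 0"
      using assms(4) by (cases; simp add: s_def)+
  qed
  have cop: "coprime (a + 1) c" "coprime c (a + 1)" "coprime (a + 1) a"
    using coprime_mult_add_1[where m = b and n = c] coprime_mult_add_1[where m = 1 and n = a]
    by (simp_all add: a)
  \<comment> \<open>These are the divisions of the three chains; the fourth and fifth continue the
    chain of \<open>c * a\<close> through \<open>a + 1\<close> and \<open>c\<close>.\<close>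
  have pe: "p = (b * (a + 1)) * c + 1" "p = b * (c * (a + 1)) + 1" "p = b * (c * a) + (a + 1)"
    "c * a = c * (a + 1) + (- c)" "a + 1 = b * c + 1"
    unfolding p power2_eq_square by (simp_all add: a algebra_simps)
  have s1: "dedekind_sum c p = reciprocity_term c p - reciprocity_term 1 c"
    using dedekind_sum_step(2)[OF pe(1)] assms(2) \<open>p > 0\<close> by (simp add: dedekind_sum_1_left)
  have s2: "dedekind_sum (c * (a + 1)) p = reciprocity_term (c * (a + 1)) p - reciprocity_term 1 (c * (a + 1))"
    using dedekind_sum_step(2)[OF pe(2)] assms(2) nz \<open>p > 0\<close> by (simp add: dedekind_sum_1_left)
  have s3: "dedekind_sum (c * a) p = reciprocity_term (c * a) p - dedekind_sum (a + 1) (c * a)"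
    using dedekind_sum_step(2)[OF pe(3)] assms(2) nz \<open>p > 0\<close> cop by simp
  have s4: "dedekind_sum (a + 1) (c * a) = reciprocity_term (a + 1) (c * a) + dedekind_sum c (a + 1)"
    using dedekind_sum_step(2)[OF pe(4)] assms(2) nz cop by (simp add: dedekind_sum_minus)
  have s5: "dedekind_sum c (a + 1) = reciprocity_term c (a + 1) - reciprocity_term 1 c"
    using dedekind_sum_step(2)[OF pe(5)] assms(2) nz by (simp add: dedekind_sum_1_left)
  define A C where "A = real_of_int a" and "C = real_of_int c"
  have P: "real_of_int p = A\<^sup>2 + A + 1" by (simp add: p A_def)
  have sgns: "sgn p = 1" "sgn c = 1" using \<open>p > 0\<close> assms(2) by simp_all
  have "real_of_int a \<noteq> 0" "real_of_int (a + 1) \<noteq> 0" "real_of_int c \<noteq> 0" "real_of_int p > 0"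
    using nz assms(2) \<open>p > 0\<close> by (simp_all only: of_int_eq_0_iff of_int_0_less_iff) auto
  then have ne: "A \<noteq> 0" "A + 1 \<noteq> 0" "C \<noteq> 0" "A\<^sup>2 + A + 1 \<noteq> 0"
    unfolding P by (simp_all add: A_def C_def)
  define Q where "Q = A\<^sup>2 + A + 1"
  have "Q \<noteq> 0" using ne by (simp add: Q_def)
  \<comment> \<open>The two occurrences of \<open>reciprocity_term 1 c\<close>, from
    \<open>s1\<close> and \<open>s5\<close>, cancel.\<close>
  have "12 * dedekind_sum3 a c p = 12 * reciprocity_term c p + 12 * reciprocity_term (c * a) p
      - 12 * reciprocity_term (a + 1) (c * a) - 12 * reciprocity_term c (a + 1)
      - 12 * reciprocity_term (c * (a + 1)) p + 12 * reciprocity_term 1 (c * (a + 1))"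
    by (simp add: dedekind_sum3_def s1 s2 s3 s4 s5)
  \<comment> \<open>The sign parts are -3, -3s, +3, +3s, +3s, -3s and add up to 0 for either value
    of \<open>s\<close>.\<close>
  also have "\<dots> = (C\<^sup>2 + Q\<^sup>2 + 1) / (C * Q) + ((C * A)\<^sup>2 + Q\<^sup>2 + 1) / (C * A * Q)
      - ((A + 1)\<^sup>2 + (C * A)\<^sup>2 + 1) / ((A + 1) * (C * A)) - (C\<^sup>2 + (A + 1)\<^sup>2 + 1) / (C * (A + 1))
      - ((C * (A + 1))\<^sup>2 + Q\<^sup>2 + 1) / (C * (A + 1) * Q) + (1\<^sup>2 + (C * (A + 1))\<^sup>2 + 1) / (1 * (C * (A + 1)))"
    using s(3)
    unfolding reciprocity_term_times_12 sgn_mult s sgns P of_int_mult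
      of_int_add of_int_1 A_def[symmetric] C_def[symmetric] Q_def[symmetric]
    by (elim disjE) simp_all
  also have "\<dots> = A * (A + C\<^sup>2) / C"
    using ne(1-3) \<open>Q \<noteq> 0\<close> by (simp add: divide_simps) (simp add: Q_def algebra_simps power2_eq_square)
  finally show ?thesis by (simp add: A_def C_def)
qed


lemma dedekind_sum_2_odd:
  fixes n :: int
  shows "coprime 2 (2 * n + 1)" and "dedekind_sum 2 (2 * n + 1) = reciprocity_term 2 (2 * n + 1)"
proof -
  have "dedekind_sum 1 2 = 0" by (simp add: dedekind_sum_1_left reciprocity_term_def)
  moreover have "2 * n + 1 \<noteq> 0" by presburger
  ultimately show "coprime 2 (2 * n + 1)" "dedekind_sum 2 (2 * n + 1) = reciprocity_term 2 (2 * n + 1)"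
    using dedekind_sum_step[of "2 * n + 1" n 2 1] by simp_all
qed

text \<open>Rounding the quotient up instead of down often gives a smaller remainder and a shorter
  chain; the remainder then enters with a plus sign.\<close>

lemma dedekind_sum_step_minus:
  fixes h k q r :: int
  assumes "k = q * h - r" "coprime r h" "h \<noteq> 0" "k \<noteq> 0"
  shows "coprime h k" and "dedekind_sum h k = reciprocity_term h k + dedekind_sum r h"
  using dedekind_sum_step[of k q h "- r"] assms by (simp_all add: dedekind_sum_minus)

text \<open>Here \<open>m\<close> represents \<open>2/3\<close> modulo \<open>p\<close>.\<close>

lemma dedekind_sum3_two_thirds_0:
  fixes a b p m :: int
  assumes a: "a = 6 * b" and b: "b \<noteq> 0" and p: "p = a\<^sup>2 + a + 1" and "3 * m = p + 2"
  shows "12 * dedekind_sum3 a m p = 6 * of_int b * (of_int b + 2)"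
proof -
  have p: "p = 36 * b\<^sup>2 + 6 * b + 1"
    unfolding p a by (simp add: power2_eq_square algebra_simps)
  with assms have m: "m = 12 * b\<^sup>2 + 2 * b + 1" by simp
  \<comment> \<open>Modulo \<open>p\<close>, \<open>x\<close> represents \<open>m * (a + 1)\<close>
    and \<open>4 * b\<close> represents \<open>m * a\<close>; the other linear forms below are
    remainders in their chains.\<close>
  define x where "x = 12 * b\<^sup>2 + 6 * b + 1"
  define B where "B = real_of_int b"
  define P where "P = 36 * B\<^sup>2 + 6 * B + 1"
  have re: "real_of_int p = 36 * B\<^sup>2 + 6 * B + 1" "real_of_int m = 12 * B\<^sup>2 + 2 * B + 1"
    "real_of_int x = 12 * B\<^sup>2 + 6 * B + 1" "real_of_int (4 * b) = 4 * B"
    "real_of_int (2 * b + 1) = 2 * B + 1" "real_of_int (12 * b + 2) = 12 * B + 2" "real_of_int (4 * b + 1) = 4 * B + 1"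
    by (simp_all add: p m x_def B_def)
  have "b\<^sup>2 \<ge> \<bar>b\<bar>" using self_le_power[of "\<bar>b\<bar>" 2] b by simp
  then have pos: "p > 0" "m > 0" "x > 0" unfolding p m x_def by linarith+
  have nz: "4 * b \<noteq> 0" "2 * b + 1 \<noteq> 0" "12 * b + 2 \<noteq> 0" "4 * b + 1 \<noteq> 0"
    using b by presburger+
  have "real_of_int p \<noteq> 0" "real_of_int m \<noteq> 0" "real_of_int x \<noteq> 0" "real_of_int (4 * b) \<noteq> 0"
    "real_of_int (2 * b + 1) \<noteq> 0" "real_of_int (12 * b + 2) \<noteq> 0" "real_of_int (4 * b + 1) \<noteq> 0"
    unfolding of_int_eq_0_iff using pos nz by auto
  note ne = this[unfolded re]
  have sgns: "sgn p = 1" "sgn m = 1" "sgn x = 1" "sgn (4 * b) = sgn b" "sgn (2 * b + 1) = sgn b"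
    "sgn (12 * b + 2) = sgn b" "sgn (4 * b + 1) = sgn b"
    using pos b by (auto simp: sgn_if)
  \<comment> \<open>In each chain the sign of \<open>b\<close> occurs squared, or linearly with
    total coefficient 0, so no case distinction on it is needed.\<close>
  have sgsq: "sgn b * sgn b = 1" using b by (simp add: sgn_if)
  have c2: "coprime 2 (2 * b + 1)" "dedekind_sum 2 (2 * b + 1) = reciprocity_term 2 (2 * b + 1)"
    by (rule dedekind_sum_2_odd)+
  \<comment> \<open>\<open>P\<close> is the real value of \<open>p\<close>. Multiplication by
    \<open>12 * P\<close> turns each Dedekind sum into a polynomial in \<open>B\<close>, so the
    final combination is a polynomial identity.\<close>
  have v1: "12 * P * dedekind_sum (m) p = 216 * B ^ 4 + 72 * B ^ 3 - 66 * B\<^sup>2 - 12 * B"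
  proof -
    have "m = 2 * (6 * b\<^sup>2 + b) + 1" by (simp add: m)
    then have "coprime 2 m" "dedekind_sum 2 m = reciprocity_term 2 m"
      using dedekind_sum_2_odd[of "6 * b\<^sup>2 + b"] by simp_all
    moreover from this have "dedekind_sum m p = reciprocity_term m p + dedekind_sum 2 m"
      using dedekind_sum_step_minus(2)[of p 3 m 2] pos by (simp add: p m)
    ultimately have "12 * P * dedekind_sum (m) p = P * (12 * reciprocity_term (m) (p) + 12 * reciprocity_term (2) (m))"
      by simp
    also have "\<dots> = 216 * B ^ 4 + 72 * B ^ 3 - 66 * B\<^sup>2 - 12 * B"
      unfolding reciprocity_term_times_12 sgns sgsq re P_def using ne(1,2)
      by (simp add: divide_simps) (simp add: algebra_simps power2_eq_square power3_eq_cube power4_eq_xxxx)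
    finally show ?thesis .
  qed
  have v2: "12 * P * dedekind_sum (4 * b) p = 288 * B ^ 3 + 102 * B\<^sup>2 + 12 * B"
  proof -
    have "coprime (2 * b + 1) (4 * b)"
      and "dedekind_sum (2 * b + 1) (4 * b) = reciprocity_term (2 * b + 1) (4 * b) + dedekind_sum 2 (2 * b + 1)"
      using dedekind_sum_step_minus[of "4 * b" 2 "2 * b + 1" 2] nz c2 by simp_all
    moreover from this have "dedekind_sum (4 * b) p = reciprocity_term (4 * b) p - dedekind_sum (2 * b + 1) (4 * b)"
      using dedekind_sum_step(2)[of p "9 * b + 1" "4 * b" "2 * b + 1"] nz pos
      by (simp add: p algebra_simps power2_eq_square)
    moreover note c2
    ultimately have "12 * P * dedekind_sum (4 * b) p = P * (12 * reciprocity_term (4 * b) (p) - 12 * reciprocity_term (2 * b + 1) (4 * b) - 12 * reciprocity_term (2) (2 * b + 1))"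
      by simp
    also have "\<dots> = 288 * B ^ 3 + 102 * B\<^sup>2 + 12 * B"
      unfolding reciprocity_term_times_12 sgns sgsq re P_def using ne(1,4,5)
      by (simp add: divide_simps) (simp add: algebra_simps power2_eq_square power3_eq_cube power4_eq_xxxx)
    finally show ?thesis .
  qed
  have v3: "12 * P * dedekind_sum (x) p = - 108 * B ^ 3 - 42 * B\<^sup>2 - 12 * B"
  proof -
    have "dedekind_sum 1 (4 * b + 1) = reciprocity_term 1 (4 * b + 1)"
      using nz by (intro dedekind_sum_1_left)
    moreover have c: "coprime (4 * b + 1) (12 * b + 2)"
      and "dedekind_sum (4 * b + 1) (12 * b + 2) = reciprocity_term (4 * b + 1) (12 * b + 2) + dedekind_sum 1 (4 * b + 1)"
      using dedekind_sum_step_minus[of "12 * b + 2" 3 "4 * b + 1" 1] nz by simp_all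
    moreover have c': "coprime (12 * b + 2) x"
      and "dedekind_sum (12 * b + 2) x = reciprocity_term (12 * b + 2) x - dedekind_sum (4 * b + 1) (12 * b + 2)"
      using dedekind_sum_step[of x b "12 * b + 2" "4 * b + 1"] nz pos c
      by (simp_all add: x_def algebra_simps power2_eq_square)
    moreover from c' have "dedekind_sum x p = reciprocity_term x p + dedekind_sum (12 * b + 2) x"
      using dedekind_sum_step_minus(2)[of p 3 x "12 * b + 2"] pos by (simp add: p x_def)
    ultimately have "12 * P * dedekind_sum (x) p = P * (12 * reciprocity_term (x) (p) + 12 * reciprocity_term (12 * b + 2) (x) - 12 * reciprocity_term (4 * b + 1) (12 * b + 2) - 12 * reciprocity_term (1) (4 * b + 1))"
      by simp
    also have "\<dots> = - 108 * B ^ 3 - 42 * B\<^sup>2 - 12 * B"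
      unfolding reciprocity_term_times_12 sgns sgsq re P_def using ne(1,3,6,7)
      by (simp add: divide_simps) (simp add: algebra_simps power2_eq_square power3_eq_cube power4_eq_xxxx)
    finally show ?thesis .
  qed
  have "dedekind_sum (m * a) p = dedekind_sum (4 * b) p"
  proof (rule dedekind_sum_cong)
    have "m * a = 4 * b + p * (2 * b)"
      by (simp add: m p a algebra_simps power2_eq_square)
    then show "[m * a = 4 * b] (mod p)" by (simp add: cong_iff_mod_eq)
  qed
  moreover have "dedekind_sum (m * (a + 1)) p = dedekind_sum x p"
  proof (rule dedekind_sum_cong)
    have "m * (a + 1) = x + p * (2 * b)"
      by (simp add: m p a x_def algebra_simps power2_eq_square)
    then show "[m * (a + 1) = x] (mod p)" by (simp add: cong_iff_mod_eq)
  qed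
  ultimately have "P * (12 * dedekind_sum3 a m p)
      = 12 * P * dedekind_sum m p + 12 * P * dedekind_sum (4 * b) p - 12 * P * dedekind_sum x p"
    by (simp add: dedekind_sum3_def algebra_simps)
  also have "\<dots> = P * (6 * B * (B + 2))"
    unfolding v1 v2 v3
    by (simp add: P_def algebra_simps power2_eq_square power3_eq_cube power4_eq_xxxx)
  finally show ?thesis using ne(1) by (simp add: P_def B_def)
qed

text \<open>For \<open>a\<close> equal to 2 modulo 6, neither \<open>a\<close> nor
  \<open>- 1 - a\<close> is divisible by 6, so \<open>dedekind_sum3_multiple\<close> does not reach
  \<open>c = 6\<close>. Both classes get explicit chains, and their values turn out to be
  equal.\<close>

lemma dedekind_sum3_two_thirds_2:
  fixes a b p m :: int
  assumes a: "a = 6 * b + 2" and p: "p = a\<^sup>2 + a + 1" and "3 * m = p + 2"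
  shows "12 * dedekind_sum3 a m p = 6 * ((of_int b)\<^sup>2 - 1)"
    and "12 * dedekind_sum3 a 6 p = 6 * ((of_int b)\<^sup>2 - 1)"
proof -
  have p: "p = 36 * b\<^sup>2 + 30 * b + 7"
    unfolding p a by (simp add: power2_eq_square algebra_simps)
  with assms have m: "m = 12 * b\<^sup>2 + 10 * b + 3" by simp
  \<comment> \<open>Modulo \<open>p\<close>, \<open>m * a\<close> is \<open>- x\<close> and
    \<open>m * (a + 1)\<close> is \<open>4 * b + 2\<close>.\<close>
  define x where "x = 12 * b\<^sup>2 + 6 * b + 1"
  \<comment> \<open>Here \<open>b = 0\<close> is allowed (\<open>a = 2\<close>,
    \<open>p = 7\<close>), so \<open>sgn b\<close> would not do. Every linear form listed below has
    its zero strictly between -1 and 0, hence this common sign.\<close>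
  define s where "s = sgn (2 * b + 1)"
  define B where "B = real_of_int b"
  define P where "P = 36 * B\<^sup>2 + 30 * B + 7"
  have re: "real_of_int p = 36 * B\<^sup>2 + 30 * B + 7" "real_of_int m = 12 * B\<^sup>2 + 10 * B + 3"
    "real_of_int x = 12 * B\<^sup>2 + 6 * B + 1" "real_of_int (12 * b + 4) = 12 * B + 4"
    "real_of_int (2 * b + 1) = 2 * B + 1" "real_of_int (4 * b + 2) = 4 * B + 2" "real_of_int (36 * b + 12) = 36 * B + 12"
    "real_of_int (18 * b + 7) = 18 * B + 7" "real_of_int (36 * b + 18) = 36 * B + 18" "real_of_int (12 * b + 7) = 12 * B + 7"
    by (simp_all add: p m x_def B_def)
  have "b\<^sup>2 \<ge> \<bar>b\<bar>" using self_le_power[of "\<bar>b\<bar>" 2] by (cases "b = 0") simp_all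
  then have pos: "p > 0" "m > 0" "x > 0" unfolding p m x_def by linarith+
  have nz: "12 * b + 4 \<noteq> 0" "2 * b + 1 \<noteq> 0" "4 * b + 2 \<noteq> 0" "36 * b + 12 \<noteq> 0" "18 * b + 7 \<noteq> 0"
    "36 * b + 18 \<noteq> 0" "12 * b + 7 \<noteq> 0"
    by presburger+
  have "real_of_int p \<noteq> 0" "real_of_int m \<noteq> 0" "real_of_int x \<noteq> 0" "real_of_int (12 * b + 4) \<noteq> 0"
    "real_of_int (2 * b + 1) \<noteq> 0" "real_of_int (4 * b + 2) \<noteq> 0" "real_of_int (36 * b + 12) \<noteq> 0"
    "real_of_int (18 * b + 7) \<noteq> 0" "real_of_int (36 * b + 18) \<noteq> 0" "real_of_int (12 * b + 7) \<noteq> 0"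
    unfolding of_int_eq_0_iff using pos nz by auto
  note ne = this[unfolded re]
  have sgns: "sgn p = 1" "sgn m = 1" "sgn x = 1" "sgn (12 * b + 4) = s" "sgn (2 * b + 1) = s" "sgn (4 * b + 2) = s"
    "sgn (36 * b + 12) = s" "sgn (18 * b + 7) = s" "sgn (36 * b + 18) = s" "sgn (12 * b + 7) = s"
    using pos by (auto simp: sgn_if s_def)
  have sgsq: "s * s = 1" using nz by (simp add: sgn_if s_def)
  have v1: "12 * P * dedekind_sum (m) p = 216 * B ^ 4 + 360 * B ^ 3 + 150 * B\<^sup>2 - 6"
  proof -
    have "m = 2 * (6 * b\<^sup>2 + 5 * b + 1) + 1" by (simp add: m)
    then have "coprime 2 m" "dedekind_sum 2 m = reciprocity_term 2 m"
      using dedekind_sum_2_odd[of "6 * b\<^sup>2 + 5 * b + 1"] by simp_all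
    moreover from this have "dedekind_sum m p = reciprocity_term m p + dedekind_sum 2 m"
      using dedekind_sum_step_minus(2)[of p 3 m 2] pos by (simp add: p m)
    ultimately have "12 * P * dedekind_sum (m) p = P * (12 * reciprocity_term (m) (p) + 12 * reciprocity_term (2) (m))"
      by simp
    also have "\<dots> = 216 * B ^ 4 + 360 * B ^ 3 + 150 * B\<^sup>2 - 6"
      unfolding reciprocity_term_times_12 sgns sgsq re P_def using ne(1,2)
      by (simp add: divide_simps) (simp add: algebra_simps power2_eq_square power3_eq_cube power4_eq_xxxx)
    finally show ?thesis .
  qed
  have v2: "12 * P * dedekind_sum (x) p = 138 * B\<^sup>2 + 120 * B + 30"
  proof -
    have c2: "coprime 2 (2 * b + 1)" and "dedekind_sum 2 (2 * b + 1) = reciprocity_term 2 (2 * b + 1)"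
      by (rule dedekind_sum_2_odd)+
    moreover have c: "coprime (2 * b + 1) (12 * b + 4)"
      and "dedekind_sum (2 * b + 1) (12 * b + 4) = reciprocity_term (2 * b + 1) (12 * b + 4) + dedekind_sum 2 (2 * b + 1)"
      using dedekind_sum_step_minus[of "12 * b + 4" 6 "2 * b + 1" 2] nz c2 by simp_all
    moreover have c': "coprime (12 * b + 4) x"
      and "dedekind_sum (12 * b + 4) x = reciprocity_term (12 * b + 4) x - dedekind_sum (2 * b + 1) (12 * b + 4)"
      using dedekind_sum_step[of x b "12 * b + 4" "2 * b + 1"] nz pos c
      by (simp_all add: x_def algebra_simps power2_eq_square)
    moreover from c' have "dedekind_sum x p = reciprocity_term x p - dedekind_sum (12 * b + 4) x"
      using dedekind_sum_step(2)[of p 3 x "12 * b + 4"] pos by (simp add: p x_def)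
    ultimately have "12 * P * dedekind_sum (x) p = P * (12 * reciprocity_term (x) (p) - 12 * reciprocity_term (12 * b + 4) (x) + 12 * reciprocity_term (2 * b + 1) (12 * b + 4) + 12 * reciprocity_term (2) (2 * b + 1))"
      by simp
    also have "\<dots> = 138 * B\<^sup>2 + 120 * B + 30"
      unfolding reciprocity_term_times_12 sgns sgsq re P_def using ne(1,3,4,5)
      by (simp add: divide_simps) (simp add: algebra_simps power2_eq_square power3_eq_cube power4_eq_xxxx)
    finally show ?thesis .
  qed
  have v3: "12 * P * dedekind_sum (4 * b + 2) p = 180 * B ^ 3 + 186 * B\<^sup>2 + 60 * B + 6"
  proof -
    have "dedekind_sum 1 (4 * b + 2) = reciprocity_term 1 (4 * b + 2)"
      using nz by (intro dedekind_sum_1_left)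
    moreover have "dedekind_sum (4 * b + 2) p = reciprocity_term (4 * b + 2) p - dedekind_sum 1 (4 * b + 2)"
      using dedekind_sum_step(2)[of p "9 * b + 3" "4 * b + 2" 1] nz pos
      by (simp add: p algebra_simps power2_eq_square)
    ultimately have "12 * P * dedekind_sum (4 * b + 2) p = P * (12 * reciprocity_term (4 * b + 2) (p) - 12 * reciprocity_term (1) (4 * b + 2))"
      by simp
    also have "\<dots> = 180 * B ^ 3 + 186 * B\<^sup>2 + 60 * B + 6"
      unfolding reciprocity_term_times_12 sgns sgsq re P_def using ne(1,6)
      by (simp add: divide_simps) (simp add: algebra_simps power2_eq_square power3_eq_cube power4_eq_xxxx)
    finally show ?thesis .
  qed
  have v4: "12 * P * dedekind_sum (6) p = 216 * B ^ 4 + 360 * B ^ 3 + 6 * B\<^sup>2 - 120 * B - 30"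
  proof -
    have "dedekind_sum 1 6 = reciprocity_term 1 6"
      by (rule dedekind_sum_1_left) simp
    moreover have "dedekind_sum 6 p = reciprocity_term 6 p - dedekind_sum 1 6"
      using dedekind_sum_step(2)[of p "6 * b\<^sup>2 + 5 * b + 1" 6 1] pos
      by (simp add: p algebra_simps power2_eq_square)
    ultimately have "12 * P * dedekind_sum (6) p = P * (12 * reciprocity_term (6) (p) - 12 * reciprocity_term (1) (6))"
      by simp
    also have "\<dots> = 216 * B ^ 4 + 360 * B ^ 3 + 6 * B\<^sup>2 - 120 * B - 30"
      unfolding reciprocity_term_times_12 sgns sgsq re P_def using ne(1)
      by (simp add: divide_simps) (simp add: algebra_simps power2_eq_square power3_eq_cube power4_eq_xxxx)
    finally show ?thesis .
  qed
  have v5: "12 * P * dedekind_sum (36 * b + 12) p = - 288 * B ^ 3 - 330 * B\<^sup>2 - 96 * B - 6"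
  proof -
    have c: "coprime 2 (18 * b + 7)" and "dedekind_sum 2 (18 * b + 7) = reciprocity_term 2 (18 * b + 7)"
      using dedekind_sum_2_odd[of "9 * b + 3"] by (simp_all add: add.commute)
    moreover have c': "coprime (18 * b + 7) (36 * b + 12)"
      and "dedekind_sum (18 * b + 7) (36 * b + 12) = reciprocity_term (18 * b + 7) (36 * b + 12) + dedekind_sum 2 (18 * b + 7)"
      using dedekind_sum_step_minus[of "36 * b + 12" 2 "18 * b + 7" 2] nz c by simp_all
    moreover have "dedekind_sum (36 * b + 12) p = reciprocity_term (36 * b + 12) p - dedekind_sum (18 * b + 7) (36 * b + 12)"
      using dedekind_sum_step(2)[of p b "36 * b + 12" "18 * b + 7"] nz pos c'
      by (simp add: p algebra_simps power2_eq_square)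
    ultimately have "12 * P * dedekind_sum (36 * b + 12) p = P * (12 * reciprocity_term (36 * b + 12) (p) - 12 * reciprocity_term (18 * b + 7) (36 * b + 12) - 12 * reciprocity_term (2) (18 * b + 7))"
      by simp
    also have "\<dots> = - 288 * B ^ 3 - 330 * B\<^sup>2 - 96 * B - 6"
      unfolding reciprocity_term_times_12 sgns sgsq re P_def using ne(1,7,8)
      by (simp add: divide_simps) (simp add: algebra_simps power2_eq_square power3_eq_cube power4_eq_xxxx)
    finally show ?thesis .
  qed
  have v6: "12 * P * dedekind_sum (36 * b + 18) p = - 108 * B ^ 3 - 150 * B\<^sup>2 - 36 * B + 6"
  proof -
    have "dedekind_sum 1 3 = reciprocity_term 1 3"
      by (rule dedekind_sum_1_left) simp
    moreover have c: "coprime 3 (12 * b + 7)"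
      and "dedekind_sum 3 (12 * b + 7) = reciprocity_term 3 (12 * b + 7) - dedekind_sum 1 3"
      using dedekind_sum_step[of "12 * b + 7" "4 * b + 2" 3 1] nz by simp_all
    moreover have c': "coprime (12 * b + 7) (36 * b + 18)"
      and "dedekind_sum (12 * b + 7) (36 * b + 18) = reciprocity_term (12 * b + 7) (36 * b + 18) + dedekind_sum 3 (12 * b + 7)"
      using dedekind_sum_step_minus[of "36 * b + 18" 3 "12 * b + 7" 3] nz c by simp_all
    moreover have "dedekind_sum (36 * b + 18) p = reciprocity_term (36 * b + 18) p - dedekind_sum (12 * b + 7) (36 * b + 18)"
      using dedekind_sum_step(2)[of p b "36 * b + 18" "12 * b + 7"] nz pos c'
      by (simp add: p algebra_simps power2_eq_square)
    ultimately have "12 * P * dedekind_sum (36 * b + 18) p = P * (12 * reciprocity_term (36 * b + 18) (p) - 12 * reciprocity_term (12 * b + 7) (36 * b + 18) - 12 * reciprocity_term (3) (12 * b + 7) + 12 * reciprocity_term (1) (3))"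
      by simp
    also have "\<dots> = - 108 * B ^ 3 - 150 * B\<^sup>2 - 36 * B + 6"
      unfolding reciprocity_term_times_12 sgns sgsq re P_def using ne(1,9,10)
      by (simp add: divide_simps) (simp add: algebra_simps power2_eq_square power3_eq_cube power4_eq_xxxx)
    finally show ?thesis .
  qed
  have "dedekind_sum (m * a) p = dedekind_sum (- x) p"
  proof (rule dedekind_sum_cong)
    have "m * a - (- x) = p * (2 * b + 1)"
      by (simp add: m p a x_def algebra_simps power2_eq_square)
    then show "[m * a = - x] (mod p)" by (simp only: cong_iff_dvd_diff dvd_triv_left)
  qed
  moreover have "dedekind_sum (m * (a + 1)) p = dedekind_sum (4 * b + 2) p"
  proof (rule dedekind_sum_cong)
    have "m * (a + 1) = (4 * b + 2) + p * (2 * b + 1)"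
      by (simp add: m p a algebra_simps power2_eq_square)
    then show "[m * (a + 1) = 4 * b + 2] (mod p)" by (simp add: cong_iff_mod_eq)
  qed
  ultimately have "P * (12 * dedekind_sum3 a m p)
      = 12 * P * dedekind_sum m p - 12 * P * dedekind_sum x p - 12 * P * dedekind_sum (4 * b + 2) p"
    by (simp add: dedekind_sum3_def dedekind_sum_minus algebra_simps)
  also have "\<dots> = P * (6 * (B\<^sup>2 - 1))"
    unfolding v1 v2 v3
    by (simp add: P_def algebra_simps power2_eq_square power3_eq_cube power4_eq_xxxx)
  finally show "12 * dedekind_sum3 a m p = 6 * ((of_int b)\<^sup>2 - 1)"
    using ne(1) by (simp add: P_def B_def)
  have "6 * a = 36 * b + 12" "6 * (a + 1) = 36 * b + 18" by (simp_all add: a)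
  then have "P * (12 * dedekind_sum3 a 6 p)
      = 12 * P * dedekind_sum 6 p + 12 * P * dedekind_sum (36 * b + 12) p - 12 * P * dedekind_sum (36 * b + 18) p"
    by (simp only: dedekind_sum3_def) (simp add: algebra_simps)
  also have "\<dots> = P * (6 * (B\<^sup>2 - 1))"
    unfolding v4 v5 v6
    by (simp add: P_def algebra_simps power2_eq_square power3_eq_cube power4_eq_xxxx)
  finally show "12 * dedekind_sum3 a 6 p = 6 * ((of_int b)\<^sup>2 - 1)"
    using ne(1) by (simp add: P_def B_def)
qed

section \<open>Cotangent sums\<close>

text \<open>Poles are harmless: \<open>cot\<close> is 0 where the sine vanishes, by division by
  zero. This matches the value 0 of the sawtooth at integers.\<close>

definition cot_sum :: "int \<Rightarrow> int \<Rightarrow> real" where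
  "cot_sum c p = (\<Sum>k\<in>{0..<p}. cot (pi * of_int k / of_int p) * cot (pi * of_int (c * k) / of_int p))"

lemma cis_eq_1_iff: "cis (2 * pi * j / p) = 1 \<longleftrightarrow> p dvd j" if "p > 0" for j p :: int
proof
  assume "cis (2 * pi * j / p) = 1"
  then have "cos (2 * pi * j / p) = 1" by (simp add: complex_eq_iff)
  then obtain n :: int where "2 * pi * j / p = of_int n * 2 * pi"
    by (auto simp: cos_one_2pi_int)
  then have "real_of_int j = of_int n * of_int p"
    using that by (simp add: field_simps)
  then have "j = n * p" by (metis of_int_eq_iff of_int_mult)
  then show "p dvd j" by simp
next
  assume "p dvd j"
  then obtain n where "j = p * n" by auto
  then have "2 * pi * j / p = 2 * pi * of_int n" using that by simp
  then show "cis (2 * pi * j / p) = 1" by (simp add: cis_multiple_2pi)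
qed

lemma sum_int_conv_nat: "(\<Sum>j\<in>{0..<int n}. f j) = (\<Sum>j<n. f (int j))"
  by (rule sum.reindex_bij_witness[of _ int nat]) auto

text \<open>Shifting \<open>j\<close> by 1 permutes the residues but multiplies the sum by
  \<open>cis (2 * pi * k / p)\<close>, so the sum is 0 unless that factor is 1.\<close>

lemma sum_cis:
  fixes p k :: int
  assumes "p > 0"
  shows "(\<Sum>j\<in>{0..<p}. cis (2 * pi * (k * j) / p)) = (if p dvd k then of_int p else 0)"
proof (cases "p dvd k")
  case True
  then have "cis (2 * pi * real_of_int (k * j) / p) = 1" for j
    using cis_eq_1_iff[OF assms, of "k * j"] by simp
  then show ?thesis using True assms by simp
next
  case False
  define F where "F = (\<lambda>j. cis (2 * pi * real_of_int (k * j) / p))"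
  have per: "F (j mod p) = F j" for j
  proof -
    have "k * j = k * (j mod p) + p * (k * (j div p))"
      by (metis distrib_left mod_mult_div_eq mult.left_commute)
    then have "2 * pi * real_of_int (k * j) / p
        = 2 * pi * real_of_int (k * (j mod p)) / p + 2 * pi * of_int (k * (j div p))"
      using assms by (simp add: field_simps)
    then show ?thesis by (simp add: F_def cis_mult[symmetric] cis_multiple_2pi)
  qed
  have "F (j + 1) = cis (2 * pi * k / p) * F j" for j
    by (simp add: F_def cis_mult add_divide_distrib algebra_simps)
  then have "cis (2 * pi * k / p) * sum F {0..<p} = sum F {0..<p}"
    using sum_residues_add[of p F 1] assms per by (simp add: sum_distrib_left)
  then have "sum F {0..<p} = 0" using False cis_eq_1_iff[OF assms, of k] by auto
  with False show ?thesis by (simp add: F_def)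
qed

lemma cot_cis:
  fixes x :: real
  assumes "sin x \<noteq> 0"
  shows "of_real (cot x) = \<i> * (1 + 2 / (cis (2 * x) - 1))"
proof -
  have "cis (2 * x) - 1 = 2 * \<i> * sin x * cis x"
    by (simp add: complex_eq_iff cos_double_sin sin_double power2_eq_square)
  then have "\<i> * (1 + 2 / (cis (2 * x) - 1)) = \<i> + inverse (cis x) / of_real (sin x)"
    using assms by (simp add: field_simps)
  also have "\<dots> = of_real (cot x)"
    using assms by (simp add: complex_eq_iff cot_def)
  finally show ?thesis by simp
qed

text \<open>Eisenstein's formula: the cotangent is the finite Fourier transform of the sawtooth,
  because the sum of j zeta^j over a period is p/(zeta - 1). It persists for \<open>p dvd k\<close>,
  where both sides are 0 by the convention for \<open>cot\<close>.\<close>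

lemma cot_eq_sum_saw:
  fixes p k :: int
  assumes "p > 0"
  shows "of_real (cot (pi * k / p)) = 2 * \<i> * (\<Sum>j\<in>{0..<p}. saw p j * cis (2 * pi * (k * j) / p))"
proof -
  define \<zeta> where "\<zeta> = cis (2 * pi * k / p)"
  have pow: "cis (2 * pi * (k * int j) / p) = \<zeta> ^ j" for j
    unfolding \<zeta>_def Complex.DeMoivre by (rule arg_cong[of _ _ cis]) simp
  \<comment> \<open>The last summand repairs the value at 0, where the linear formula would give
    -1/2.\<close>
  have saw: "saw p j = j / p - 1 / 2 + (if j = 0 then 1 / 2 else 0)" if "j \<in> {0..<p}" for j
    using that by (auto simp: saw_def zdvd_not_zless)
  have "(\<Sum>j\<in>{0..<p}. saw p j * cis (2 * pi * (k * j) / p))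
     = (\<Sum>j\<in>{0..<p}. j / p * cis (2 * pi * (k * j) / p) - 1 / 2 * cis (2 * pi * (k * j) / p)
           + (if j = 0 then 1 / 2 else 0))"
    by (intro sum.cong refl) (auto simp: saw algebra_simps)
  also have "\<dots> = (\<Sum>j\<in>{0..<p}. j / p * cis (2 * pi * (k * j) / p))
       - 1 / 2 * (\<Sum>j\<in>{0..<p}. cis (2 * pi * (k * j) / p)) + 1 / 2"
    using assms by (simp add: sum.distrib sum_subtractf sum_distrib_left)
  finally have *: "(\<Sum>j\<in>{0..<p}. saw p j * cis (2 * pi * (k * j) / p)) =
      (\<Sum>j\<in>{0..<p}. j / p * cis (2 * pi * (k * j) / p))
       - 1 / 2 * (if p dvd k then of_int p else 0) + 1 / 2"
    by (simp only: sum_cis[OF assms])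
  show ?thesis
  proof (cases "p dvd k")
    case True
    then have "cis (2 * pi * (k * j) / p) = 1" for j
      using cis_eq_1_iff[OF assms, of "k * j"] by simp
    then have "(\<Sum>j\<in>{0..<p}. j / p * cis (2 * pi * (k * j) / p)) = of_int (\<Sum>j\<in>{0..<p}. j) / of_int p"
      by (simp add: sum_divide_distrib)
    also have "\<dots> = of_int (2 * (\<Sum>j\<in>{0..<p}. j)) / (2 * of_int p)" by simp
    also have "2 * (\<Sum>j\<in>{0..<p}. j) = p * (p - 1)" using assms by (intro sum_ints) auto
    also have "complex_of_int (p * (p - 1)) / (2 * of_int p) = (of_int p - 1) / 2" using assms by simp
    finally have "(\<Sum>j\<in>{0..<p}. saw p j * cis (2 * pi * (k * j) / p)) = 0"
      unfolding * using True by (simp add: field_simps)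
    moreover have "cot (pi * k / p) = 0"
      using True assms by (auto simp: cot_def sin_zero_iff_int2)
    ultimately show ?thesis by simp
  next
    case False
    then have z1: "\<zeta> \<noteq> 1" using cis_eq_1_iff[OF assms, of k] by (simp add: \<zeta>_def)
    define P where "P = (\<Sum>j\<in>{0..<p}. j / p * cis (2 * pi * (k * j) / p))"
    define n where "n = nat p"
    have p: "p = int n" "n > 0" using assms by (auto simp: n_def)
    have zn: "\<zeta> ^ n = 1" using pow[of n] cis_eq_1_iff[OF assms, of "k * p"] p by simp
    have P: "of_nat n * P = (\<Sum>j<n. of_nat j * \<zeta> ^ j)"
      unfolding P_def p sum_int_conv_nat sum_distrib_left
      by (intro sum.cong refl) (use p pow in simp)
    \<comment> \<open>Summation by parts; at a root of unity only the boundary term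
      survives.\<close>
    have tel: "(\<zeta> - 1) * (\<Sum>j<m. of_nat j * \<zeta> ^ j) = of_nat m * \<zeta> ^ m - (\<Sum>j<m. \<zeta> ^ Suc j)" for m
      by (induction m) (simp_all add: algebra_simps)
    have "(\<Sum>j<n. \<zeta> ^ Suc j) = \<zeta> * (\<Sum>j<n. \<zeta> ^ j)" by (simp add: sum_distrib_left)
    also have "(\<Sum>j<n. \<zeta> ^ j) = 0" using z1 zn by (simp add: geometric_sum)
    finally have "(\<zeta> - 1) * (of_nat n * P) = of_nat n" using tel[of n] P zn by simp
    then have "of_nat n * ((\<zeta> - 1) * P) = of_nat n * 1" by (simp only: mult.left_commute mult_1_right)
    then have "(\<zeta> - 1) * P = 1" using p(2) by (simp only: mult_cancel_left) simp
    then have P: "P = 1 / (\<zeta> - 1)" using z1 by (simp add: field_simps)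
    have "sin (pi * k / p) \<noteq> 0"
    proof
      assume "sin (pi * k / p) = 0"
      then obtain i :: int where "pi * k / p = of_int i * pi" by (auto simp: sin_zero_iff_int2)
      then have "real_of_int k = of_int (i * p)" using assms by (simp add: field_simps)
      with False show False by (metis dvd_triv_right of_int_eq_iff)
    qed
    from cot_cis[OF this] have "complex_of_real (cot (pi * k / p)) = \<i> * (1 + 2 / (\<zeta> - 1))"
      by (simp add: \<zeta>_def mult_ac)
    also have "\<dots> = 2 * \<i> * (P + 1 / 2)" by (simp add: P algebra_simps)
    finally show ?thesis unfolding * P_def using False by simp
  qed
qed

text \<open>A Parseval argument: after both cotangents are expanded, the sum over \<open>k\<close>
  forces \<open>j\<close> to be \<open>- c * l\<close> modulo \<open>p\<close> and contributes
  \<open>p\<close>. The minus sign of (2i)^2 = -4 is absorbed by the oddness of the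
  sawtooth.\<close>

lemma cot_sum_eq_dedekind_sum:
  assumes "p > 0" "coprime c p"
  shows "cot_sum c p = 4 * of_int p * dedekind_sum c p"
proof -
  let ?e = "\<lambda>i. cis (2 * pi * real_of_int i / p)"
  have "complex_of_real (cot_sum c p) = (\<Sum>k\<in>{0..<p}.
      (2 * \<i> * (\<Sum>j\<in>{0..<p}. saw p j * ?e (k * j))) * (2 * \<i> * (\<Sum>l\<in>{0..<p}. saw p l * ?e (c * k * l))))"
    unfolding cot_sum_def by (simp add: cot_eq_sum_saw[OF assms(1)] del: of_int_mult)
  also have "\<dots> = - 4 * (\<Sum>k\<in>{0..<p}. \<Sum>j\<in>{0..<p}. \<Sum>l\<in>{0..<p}. saw p j * saw p l * ?e ((j + c * l) * k))"
  proof -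
    have "(\<Sum>j\<in>{0..<p}. saw p j * ?e (k * j)) * (\<Sum>l\<in>{0..<p}. saw p l * ?e (c * k * l))
        = (\<Sum>j\<in>{0..<p}. \<Sum>l\<in>{0..<p}. saw p j * saw p l * ?e ((j + c * l) * k))" for k
    proof -
      have "?e (k * j) * ?e (c * k * l) = ?e ((j + c * l) * k)" for j l
        unfolding cis_mult by (rule arg_cong[of _ _ cis]) (simp add: add_divide_distrib algebra_simps)
      then show ?thesis
        unfolding sum_product by (intro sum.cong refl) (simp add: mult_ac)
    qed
    moreover have "(2 * \<i> * a) * (2 * \<i> * b) = - 4 * (a * b)" for a b by simp
    ultimately show ?thesis by (simp only: sum_distrib_left[symmetric, of "- 4"])
  qed
  also have "(\<Sum>k\<in>{0..<p}. \<Sum>j\<in>{0..<p}. \<Sum>l\<in>{0..<p}. saw p j * saw p l * ?e ((j + c * l) * k))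
     = (\<Sum>l\<in>{0..<p}. \<Sum>j\<in>{0..<p}. saw p j * saw p l * (\<Sum>k\<in>{0..<p}. ?e ((j + c * l) * k)))"
    unfolding sum_distrib_left
    by (subst sum.swap, subst (2) sum.swap, subst sum.swap) (rule refl)
  also have "\<dots> = (\<Sum>l\<in>{0..<p}. \<Sum>j\<in>{0..<p}. if j = (- c * l) mod p then complex_of_real (of_int p * (saw p j * saw p l)) else 0)"
  proof (intro sum.cong refl)
    fix l j assume "j \<in> {0..<p}"
    then have "p dvd j + c * l \<longleftrightarrow> j = (- c * l) mod p"
      by (metis (no_types, opaque_lifting) add.commute add.inverse_inverse atLeastLessThan_iff
          diff_minus_eq_add mod_eq_dvd_iff mod_pos_pos_trivial mult_minus_left)
    then show "saw p j * saw p l * (\<Sum>k\<in>{0..<p}. ?e ((j + c * l) * k)) =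
       (if j = (- c * l) mod p then complex_of_real (of_int p * (saw p j * saw p l)) else 0)"
      unfolding sum_cis[OF assms(1)] by simp
  qed
  also have "\<dots> = (\<Sum>l\<in>{0..<p}. complex_of_real (of_int p * (saw p (- c * l) * saw p l)))"
    using assms(1) by (simp add: sum.delta)
  also have "- 4 * \<dots> = of_real (4 * of_int p * dedekind_sum c p)"
    using assms(1) by (simp add: dedekind_sum_def saw_minus sum_distrib_left sum_negf mult_ac)
  finally show ?thesis by (simp only: of_real_eq_iff)
qed

section \<open>L-series of odd periodic functions\<close>

text \<open>\<open>F\<close> is constant on the interval from 0 to 1 by the reflection formula for
  \<open>Gamma\<close>; the claim is that its derivative vanishes.\<close>

lemma Digamma_reflection:
  fixes x :: real
  assumes "0 < x" "x < 1"
  shows "Digamma (1 - x) - Digamma x = pi * cot (pi * x)"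
proof -
  define F where "F = (\<lambda>x::real. Gamma x * Gamma (1 - x) * sin (pi * x))"
  have F: "F y = pi" if "y \<in> {0<..<1}" for y
  proof -
    have "complex_of_real (Gamma y * Gamma (1 - y)) = of_real (pi / sin (pi * y))"
      using Gamma_reflection_complex[of "of_real y"]
      by (simp add: Gamma_complex_of_real[symmetric] sin_of_real[symmetric])
    then have "Gamma y * Gamma (1 - y) = pi / sin (pi * y)"
      by (simp only: of_real_eq_iff)
    moreover have "sin (pi * y) \<noteq> 0"
      using that by (intro order.strict_implies_not_eq[symmetric] sin_gt_zero) auto
    ultimately show ?thesis by (simp add: F_def)
  qed
  have nonpos: "y \<notin> \<int>\<^sub>\<le>\<^sub>0" if "y > 0" for y :: real
    using that by (auto elim!: nonpos_Ints_cases)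
  have "(F has_field_derivative
     (Gamma x * Digamma x * Gamma (1 - x) - Gamma x * (Gamma (1 - x) * Digamma (1 - x))) * sin (pi * x)
       + Gamma x * Gamma (1 - x) * (pi * cos (pi * x))) (at x)"
    unfolding F_def using assms nonpos[of x] nonpos[of "1 - x"]
    by (auto intro!: derivative_eq_intros simp: algebra_simps)
  moreover have "(F has_field_derivative 0) (at x)"
  proof -
    have "((\<lambda>_. pi) has_field_derivative 0) (at x)" by simp
    then show ?thesis
      by (rule has_field_derivative_transform_within_open[of _ _ _ "{0<..<1}"]) (use assms F in auto)
  qed
  ultimately have "(Gamma x * Digamma x * Gamma (1 - x) - Gamma x * (Gamma (1 - x) * Digamma (1 - x))) * sin (pi * x)
       + Gamma x * Gamma (1 - x) * (pi * cos (pi * x)) = 0"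
    by (rule DERIV_unique)
  then have "Gamma x * Gamma (1 - x) * ((Digamma x - Digamma (1 - x)) * sin (pi * x) + pi * cos (pi * x)) = 0"
    by (simp add: algebra_simps)
  moreover have "Gamma x > 0" "Gamma (1 - x) > 0" using assms by (auto intro: Gamma_real_pos)
  ultimately have "(Digamma x - Digamma (1 - x)) * sin (pi * x) + pi * cos (pi * x) = 0" by simp
  moreover have "sin (pi * x) > 0" using assms by (intro sin_gt_zero) auto
  ultimately show ?thesis by (simp add: cot_def field_simps)
qed

text \<open>An arbitrary partial sum differs from the nearest block sum below it by fewer than
  \<open>p\<close> terms, each tending to 0.\<close>

lemma sums_of_block_sums:
  fixes f :: "nat \<Rightarrow> 'a::real_normed_vector"
  assumes "p > 0" and lim: "(\<lambda>m. \<Sum>n<p * m. f n) \<longlonglongrightarrow> L" and null: "f \<longlonglongrightarrow> 0"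
  shows "f sums L"
proof -
  \<comment> \<open>Summing over all \<open>r < p\<close> bounds the incomplete block independently
    of \<open>N mod p\<close>.\<close>
  have "(\<lambda>N. \<Sum>r<p. norm (f (p * (N div p) + r))) \<longlonglongrightarrow> (\<Sum>r<p. 0)"
  proof (intro tendsto_sum tendsto_norm_zero)
    fix r
    have "filterlim (\<lambda>N. p * (N div p) + r) sequentially sequentially"
      unfolding filterlim_at_top
    proof
      fix Z
      show "\<forall>\<^sub>F N in sequentially. Z \<le> p * (N div p) + r"
        using eventually_ge_at_top[of "Z + p"]
      proof eventually_elim
        case (elim N)
        have "N mod p < p" using assms(1) by simp
        moreover have "p * (N div p) + N mod p = N" by simp
        ultimately show ?case using elim by linarith
      qed
    qed
    then show "(\<lambda>N. f (p * (N div p) + r)) \<longlonglongrightarrow> 0" by (rule filterlim_compose[OF null])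
  qed
  then have bound: "(\<lambda>N. \<Sum>r<p. norm (f (p * (N div p) + r))) \<longlonglongrightarrow> 0" by simp
  have "(\<lambda>N. (\<Sum>n<N. f n) - (\<Sum>n<p * (N div p). f n)) \<longlonglongrightarrow> 0"
  proof (rule Lim_null_comparison[OF always_eventually bound], rule allI)
    fix N
    have "{..<q + r} = {..<q} \<union> {q..<q + r}" for q r :: nat
      by auto
    from this[of "p * (N div p)" "N mod p"]
    have "{..<N} = {..<p * (N div p)} \<union> {p * (N div p)..<p * (N div p) + N mod p}"
      by simp
    then have "(\<Sum>n<N. f n) = (\<Sum>n<p * (N div p). f n) + (\<Sum>n\<in>{p * (N div p)..<p * (N div p) + N mod p}. f n)"
      by (metis finite_atLeastLessThan finite_lessThan ivl_disj_int_one(2) sum.union_disjoint)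
    also have "(\<Sum>n\<in>{p * (N div p)..<p * (N div p) + N mod p}. f n) = (\<Sum>r<N mod p. f (p * (N div p) + r))"
      by (simp add: sum.shift_bounds_nat_ivl[of f 0 "p * (N div p)" "N mod p", simplified]
          atLeast0LessThan add.commute)
    finally have "norm ((\<Sum>n<N. f n) - (\<Sum>n<p * (N div p). f n)) \<le> (\<Sum>r<N mod p. norm (f (p * (N div p) + r)))"
      by (simp add: norm_sum)
    also have "\<dots> \<le> (\<Sum>r<p. norm (f (p * (N div p) + r)))"
      using assms(1) by (intro sum_mono2) (auto intro: less_trans)
    finally show "norm ((\<Sum>n<N. f n) - (\<Sum>n<p * (N div p). f n)) \<le> (\<Sum>r<p. norm (f (p * (N div p) + r)))" .
  qed
  moreover have "(\<lambda>N. \<Sum>n<p * (N div p). f n) \<longlonglongrightarrow> L"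
    by (rule filterlim_compose[OF lim filterlim_at_top_div_const_nat[OF assms(1)]])
  ultimately have "(\<lambda>N. (\<Sum>n<N. f n) - (\<Sum>n<p * (N div p). f n) + (\<Sum>n<p * (N div p). f n)) \<longlonglongrightarrow> 0 + L"
    by (rule tendsto_add)
  then show ?thesis by (simp add: sums_def)
qed

text \<open>On a fixed class the partial sums of 1/(k/p + n) grow like \<open>ln m\<close>. As
  \<open>f\<close> sums to 0 over a period, the logarithms cancel and digamma values at k/p remain;
  pairing k with p - k turns them into cotangents. The terms at 0 vanish on both sides.\<close>

lemma sums_odd_periodic:
  fixes f :: "int \<Rightarrow> complex" and p :: nat
  assumes p: "p > 0" and per: "\<And>k. f (k + int p) = f k" and odd: "\<And>k. f (- k) = - f k"
  shows "(\<lambda>n. f (int n) / of_nat n) sums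
           (of_real (pi / (2 * p)) * (\<Sum>k<p. f (int k) * of_real (cot (pi * k / p))))"
proof (rule sums_of_block_sums[OF p])
  have f0: "f 0 = 0" using odd[of 0] by simp
  have per': "f (k + int p * n) = f k" for k and n :: nat
  proof (induction n)
    case (Suc n)
    then show ?case using per[of "k + int p * n"] by (simp add: algebra_simps)
  qed simp
  have flip_f: "f (int p - int k) = - f (int k)" for k
    using per[of "- int k"] odd[of "int k"] by simp
  define S where "S = {1..<p}"
  have flip: "(\<Sum>k\<in>S. g k) = (\<Sum>k\<in>S. g (p - k))" for g :: "nat \<Rightarrow> complex"
    by (rule sum.reindex_bij_witness[of _ "\<lambda>k. p - k" "\<lambda>k. p - k"]) (auto simp: S_def)
  have S: "(\<Sum>k<p. g k) = (\<Sum>k\<in>S. g k)" if "g 0 = 0" for g :: "nat \<Rightarrow> complex"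
    by (rule sum.mono_neutral_right) (use that in \<open>auto simp: S_def Suc_le_eq\<close>)
  have sum0: "(\<Sum>k\<in>S. f (int k)) = 0"
  proof -
    have "(\<Sum>k\<in>S. f (int k)) = (\<Sum>k\<in>S. - f (int k))"
      by (subst flip) (intro sum.cong refl, auto simp: S_def flip_f of_nat_diff)
    then show ?thesis by (simp add: sum_negf)
  qed
  have block: "(\<Sum>n<p * m. f (int n) / of_nat n)
      = - (\<Sum>k\<in>S. f (int k) / p * of_real (ln m - (\<Sum>n<m. inverse (real k / real p + real n))))" for m
  proof -
    have "(\<Sum>n<p * m. f (int n) / of_nat n) = (\<Sum>n<m. \<Sum>k<p. f (int (n * p + k)) / of_nat (n * p + k))"
    proof -
      have "(\<Sum>k = n * p..<n * p + p. g k) = (\<Sum>k<p. g (n * p + k))" for g :: "nat \<Rightarrow> complex" and n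
        using sum.shift_bounds_nat_ivl[of g 0 "n * p" p] by (simp add: atLeast0LessThan add.commute)
      then show ?thesis
        by (simp only: mult.commute[of p m] sum.nat_group[symmetric])
    qed
    also have "\<dots> = (\<Sum>n<m. \<Sum>k\<in>S. f (int k) / p * of_real (inverse (real k / real p + real n)))"
    proof (rule sum.cong[OF refl])
      fix n
      have f: "f (int (n * p + k)) = f (int k)" for k
        using per'[of "int k" n] by (simp add: algebra_simps)
      have "of_nat (n * p + k) = (of_nat p :: complex) * of_real (real k / real p + real n)" for k
        using p by (simp add: field_simps)
      then have "f (int (n * p + k)) / of_nat (n * p + k) = f (int k) / p * of_real (inverse (real k / real p + real n))" for k
        by (simp only: f of_real_inverse) (simp add: divide_inverse)
      then show "(\<Sum>k<p. f (int (n * p + k)) / of_nat (n * p + k))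
          = (\<Sum>k\<in>S. f (int k) / p * of_real (inverse (real k / real p + real n)))"
        by (simp only:) (rule S, simp add: f0)
    qed
    also have "\<dots> = (\<Sum>k\<in>S. f (int k) / p * of_real (\<Sum>n<m. inverse (real k / real p + real n)))"
      by (subst sum.swap) (simp add: sum_distrib_left)
    \<comment> \<open>The added summand is 0 by \<open>sum0\<close>; it supplies the
      \<open>ln m\<close> that makes each inner sequence converge.\<close>
    also have "\<dots> = (\<Sum>k\<in>S. f (int k)) * (- ln m / p) + (\<Sum>k\<in>S. f (int k) / p * of_real (\<Sum>n<m. inverse (real k / real p + real n)))"
      by (simp add: sum0)
    also have "\<dots> = - (\<Sum>k\<in>S. f (int k) / p * of_real (ln m - (\<Sum>n<m. inverse (real k / real p + real n))))"
      unfolding sum_distrib_right sum.distrib[symmetric] sum_negf[symmetric]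
      by (intro sum.cong refl) (simp add: algebra_simps)
    finally show ?thesis .
  qed
  have "(\<lambda>m. - (\<Sum>k\<in>S. f (int k) / p * of_real (ln m - (\<Sum>n<m. inverse (real k / real p + real n)))))
      \<longlonglongrightarrow> - (\<Sum>k\<in>S. f (int k) / p * of_real (Digamma (k / p)))"
  proof (intro tendsto_intros)
    fix k assume "k \<in> S"
    then show "(\<lambda>m. ln (real m) - (\<Sum>n<m. inverse (real k / real p + real n))) \<longlonglongrightarrow> Digamma (k / p)"
      using Digamma_LIMSEQ[of "k / p :: real"] by (simp add: S_def)
  qed
  also have "- (\<Sum>k\<in>S. f (int k) / p * of_real (Digamma (k / p)))
      = of_real (pi / (2 * p)) * (\<Sum>k<p. f (int k) * of_real (cot (pi * k / p)))"
  proof -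
    let ?D = "\<Sum>k\<in>S. f (int k) * of_real (Digamma (k / p))"
    \<comment> \<open>Adding \<open>?D\<close> to its image under the reflection of k to p - k
      produces the difference evaluated by \<open>Digamma_reflection\<close>.\<close>
    have "?D = (\<Sum>k\<in>S. - (f (int k) * of_real (Digamma (1 - k / p))))"
      by (subst flip) (intro sum.cong refl, use p in \<open>auto simp: S_def flip_f of_nat_diff diff_divide_distrib\<close>)
    then have "2 * ?D = - (\<Sum>k\<in>S. f (int k) * of_real (Digamma (1 - k / p) - Digamma (k / p)))"
      by (simp add: sum_negf algebra_simps sum_subtractf)
    also have "\<dots> = - (\<Sum>k\<in>S. f (int k) * of_real (pi * cot (pi * k / p)))"
      using Digamma_reflection[of "real k / p" for k] by (simp add: S_def)
    also have "\<dots> = - pi * (\<Sum>k<p. f (int k) * of_real (cot (pi * k / p)))"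
      by (subst S) (auto simp: f0 sum_distrib_left sum_negf mult_ac)
    finally have D: "2 * ?D = - pi * (\<Sum>k<p. f (int k) * of_real (cot (pi * k / p)))" .
    have "- (\<Sum>k\<in>S. f (int k) / p * of_real (Digamma (k / p))) = - (2 * ?D) / (2 * of_nat p)"
      by (simp add: sum_divide_distrib sum_negf)
    then show ?thesis unfolding D by simp
  qed
  finally show "(\<lambda>m. \<Sum>n<p * m. f (int n) / of_nat n) \<longlonglongrightarrow>
      of_real (pi / (2 * p)) * (\<Sum>k<p. f (int k) * of_real (cot (pi * k / p)))"
    unfolding block .
  show "(\<lambda>n. f (int n) / of_nat n) \<longlonglongrightarrow> 0"
  proof (rule Lim_null_comparison[OF always_eventually])
    show "\<forall>n. norm (f (int n) / of_nat n) \<le> (\<Sum>k<p. norm (f (int k))) / real n"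
    proof
      fix n
      have "f (int n) = f (int (n mod p))"
        using per'[of "int (n mod p)" "n div p"] by (simp flip: of_nat_mult of_nat_add)
      then have "norm (f (int n)) \<le> (\<Sum>k<p. norm (f (int k)))"
        using p by (auto intro: member_le_sum)
      then show "norm (f (int n) / of_nat n) \<le> (\<Sum>k<p. norm (f (int k))) / real n"
        by (simp add: norm_divide divide_right_mono)
    qed
    show "(\<lambda>n. (\<Sum>k<p. norm (f (int k))) / real n) \<longlonglongrightarrow> 0" by (rule lim_const_over_n)
  qed
qed

section \<open>Odd characters trivial on the cubic subgroup\<close>

text \<open>Since p = a^2 + a + 1, the factor j^2 + j + 1 of j^3 - 1 equals (j - a)(j + 1 + a) +
  p.\<close>

lemma cube_roots_mod_prime:
  fixes a :: int
  assumes "prime p" "int p = a\<^sup>2 + a + 1"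
  shows "[j ^ 3 = 1] (mod int p) \<longleftrightarrow> [j = 1] (mod int p) \<or> [j = a] (mod int p) \<or> [j = - 1 - a] (mod int p)"
proof -
  have "j ^ 3 - 1 = (j - 1) * ((j - a) * (j - (- 1 - a))) + int p * (j - 1)"
    unfolding assms(2) by (simp add: algebra_simps power2_eq_square power3_eq_cube)
  then have "[j ^ 3 = 1] (mod int p) \<longleftrightarrow> int p dvd (j - 1) * ((j - a) * (j - (- 1 - a)))"
    unfolding cong_iff_dvd_diff by (simp add: dvd_add_left_iff)
  then show ?thesis
    using assms(1) by (simp add: prime_dvd_mult_iff cong_iff_dvd_diff)
qed

text \<open>By Lagrange every element of \<open>H\<close> is a cube root of 1, and there are at most
  three of these.\<close>

lemma subgroup_order_3_eq:
  fixes a :: int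
  assumes "prime p" "int p = a\<^sup>2 + a + 1" "subgroup H (units_of (residue_ring (int p)))" "card H = 3"
  shows "H = {1, a mod int p, (- 1 - a) mod int p}"
proof -
  interpret residues_prime p "residue_ring (int p)"
    by (unfold_locales, fact)
  let ?U = "units_of (residue_ring (int p))"
  have p: "int p > 1" using prime_gt_1_nat[OF assms(1)] by simp
  interpret U: group ?U by (rule units_group)
  interpret H: group "?U\<lparr>carrier := H\<rparr>"
    by (rule U.subgroup_imp_group) fact
  have "H \<subseteq> {1, a mod int p, (- 1 - a) mod int p}"
  proof
    fix h assume h: "h \<in> H"
    with assms(3) have hU: "h \<in> Units (residue_ring (int p))"
      by (auto simp: units_of_def dest: subgroup.mem_carrier)
    then have range: "0 \<le> h" "h < int p" by (auto simp: res_units_eq)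
    have "h [^]\<^bsub>?U\<lparr>carrier := H\<rparr>\<^esub> (3::nat) = \<one>\<^bsub>?U\<lparr>carrier := H\<rparr>\<^esub>"
      using H.pow_order_eq_1[of h] h assms(4) by (simp add: Coset.order_def)
    then have "h [^]\<^bsub>residue_ring (int p)\<^esub> (3::nat) = 1"
      using units_of_pow[OF hU, of 3] U.nat_pow_consistent[of h 3 H]
      by (simp add: units_of_one res_one_eq)
    then have "h ^ 3 mod int p = 1"
      using pow_cong[of h 3] range by simp
    then have "[h ^ 3 = 1] (mod int p)" using p by (simp add: cong_iff_mod_eq)
    then have "h mod int p = 1 mod int p \<or> h mod int p = a mod int p \<or> h mod int p = (- 1 - a) mod int p"
      using cube_roots_mod_prime[OF assms(1,2)] by (simp add: cong_iff_mod_eq)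
    then show "h \<in> {1, a mod int p, (- 1 - a) mod int p}"
      using range p by auto
  qed
  moreover have "card {1, a mod int p, (- 1 - a) mod int p} \<le> card H"
    unfolding assms(4) by (simp add: card_insert_if)
  ultimately show ?thesis
    by (intro card_seteq) auto
qed

section \<open>Elementary properties of Dirichlet characters\<close>

context
  fixes p :: nat and \<psi> :: "int \<Rightarrow> complex"
  assumes p: "p > 1" and char: "dirichlet_character p \<psi>"
begin

lemma character_mult: "\<psi> (k * l) = \<psi> k * \<psi> l"
  and character_eq_0_iff: "\<psi> k = 0 \<longleftrightarrow> \<not> coprime k (int p)"
  and character_add: "\<psi> (k + int p) = \<psi> k"
  using char by (auto simp: dirichlet_character_def)

lemma character_1: "\<psi> 1 = 1"
  using character_mult[of 1 1] character_eq_0_iff[of 1] by simp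

lemma character_power: "\<psi> (k ^ n) = \<psi> k ^ n"
  by (induction n) (simp_all add: character_1 character_mult)

lemma character_mod: "\<psi> (k mod int p) = \<psi> k"
proof -
  have *: "\<psi> (k + int p * int n) = \<psi> k" for k n
  proof (induction n)
    case (Suc n)
    then show ?case using character_add[of "k + int p * int n"] by (simp add: algebra_simps)
  qed simp
  have "k mod int p = k + int p * (- (k div int p))"
    by (simp add: minus_mult_div_eq_mod[symmetric])
  then show ?thesis
  proof (cases "k div int p \<ge> 0")
    case True
    then show ?thesis using *[of "k mod int p" "nat (k div int p)"] by simp
  next
    case False
    then show ?thesis using *[of k "nat (- (k div int p))"] \<open>k mod int p = _\<close> by simp
  qed
qed

lemma character_cong: "[k = l] (mod int p) \<Longrightarrow> \<psi> k = \<psi> l"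
  by (metis character_mod cong_iff_mod_eq)

text \<open>By Euler's theorem the value is a root of unity.\<close>

lemma norm_character:
  assumes "coprime k (int p)"
  shows "norm (\<psi> k) = 1"
proof -
  have "[nat (k mod int p) ^ totient p = 1] (mod p)"
    using assms p by (intro euler_theorem) (simp add: coprime_commute flip: coprime_int_iff)
  then have "[(k mod int p) ^ totient p = 1] (mod int p)"
    using p by (simp flip: cong_int_iff)
  then have "\<psi> k ^ totient p = 1"
    using character_cong character_1 character_power character_mod by metis
  then have "norm (\<psi> k) ^ totient p = 1" by (metis norm_one norm_power)
  then show ?thesis
    using p power_eq_imp_eq_base[of "norm (\<psi> k)" "totient p" 1] by simp
qed

end

text \<open>A primitive n-th root of unity \<open>w\<close> permutes the solutions by
  multiplication, so the sum is unchanged by the factor \<open>w ^ t\<close>, which is 1 only if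
  \<open>n dvd t\<close>.\<close>

lemma sum_power_roots:
  fixes t :: nat
  assumes "n > 0"
  shows "(\<Sum>z | z ^ n = (- 1 :: complex). z ^ t) = (if n dvd t then (- 1) ^ (t div n) * of_nat n else 0)"
proof (cases "n dvd t")
  case True
  then obtain u where t: "t = n * u" by auto
  have "(\<Sum>z | z ^ n = (- 1 :: complex). z ^ t) = (\<Sum>z | z ^ n = (- 1 :: complex). (- 1) ^ u)"
    by (intro sum.cong) (auto simp: t power_mult)
  then show ?thesis using card_nth_roots[of "- 1" n] assms t by simp
next
  case False
  define w where "w = cis (2 * pi / n)"
  let ?Z = "{z. z ^ n = (- 1 :: complex)}"
  have wn: "w ^ n = 1" using assms by (simp add: w_def Complex.DeMoivre)
  have wt: "w ^ t \<noteq> 1"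
  proof
    assume "w ^ t = 1"
    then have "cos (2 * pi * t / n) = 1" by (simp add: w_def Complex.DeMoivre complex_eq_iff mult_ac)
    then obtain k :: int where "2 * pi * t / n = of_int k * 2 * pi" by (auto simp: cos_one_2pi_int)
    then have "real t = of_int k * n" using assms by (simp add: field_simps)
    then have "int t = k * int n" by (metis of_int_eq_iff of_int_mult of_int_of_nat_eq)
    then have "int n dvd int t" by simp
    with False show False by (simp only: int_dvd_int_iff)
  qed
  have "(\<Sum>z\<in>?Z. z ^ t) = (\<Sum>z\<in>?Z. (w * z) ^ t)"
    using wn by (intro sum.reindex_bij_witness[of _ "\<lambda>z. w * z" "\<lambda>z. z / w"])
      (auto simp: power_mult_distrib power_divide w_def)
  also have "\<dots> = w ^ t * (\<Sum>z\<in>?Z. z ^ t)"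
    by (simp add: power_mult_distrib sum_distrib_left)
  finally have "(\<Sum>z\<in>?Z. z ^ t) = 0" using wt by simp
  with False show ?thesis by simp
qed

text \<open>For a primitive root \<open>g\<close>, -1 is \<open>g ^ (3 * n)\<close> and the cubic
  subgroup is generated by \<open>g ^ (2 * n)\<close>. Hence oddness and triviality on it amount to
  \<open>z ^ n = - 1\<close> for the value \<open>z\<close> at \<open>g\<close>, and
  \<open>sum_power_roots\<close> applies. The cube conditions on \<open>m\<close> encode membership
  in H and in -H.\<close>

lemma odd_chars_orthogonality:
  fixes a :: int
  assumes "prime p" "p = 6 * n + 1" "int p = a\<^sup>2 + a + 1"
  defines "X \<equiv> odd_chars_trivial_on p {1, a mod int p, (- 1 - a) mod int p}"
  shows "card X > 0"
    and "(\<Sum>\<psi>\<in>X. \<psi> m) = of_nat (card X) * (of_bool [m ^ 3 = 1] (mod int p) - of_bool [m ^ 3 = - 1] (mod int p))"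
proof -
  have p1: "p > 1" using assms(1) prime_gt_1_nat by auto
  have n0: "n > 0" using p1 assms(2) by (cases n) auto
  have tot: "totient p = 6 * n" using assms(1,2) by (simp add: totient_prime)
  obtain g where g: "residue_primroot p g"
    using prime_primitive_root_exists[of p] assms(1) p1 by auto
  have ord: "ord p g = 6 * n" and copg: "coprime p g"
    using g tot by (auto simp: residue_primroot_def)
  have expo: "[int g ^ s = int g ^ t] (mod int p) \<longleftrightarrow> [s = t] (mod 6 * n)" for s t
    using order_divides_expdiff[OF copg, of s t] by (simp add: ord flip: cong_int_iff)
  have gen: "\<exists>t. [k = int g ^ t] (mod int p)" if "coprime k (int p)" for k
  proof -
    have r: "int (nat (k mod int p)) = k mod int p" using p1 by simp
    then have "coprime (int (nat (k mod int p))) (int p)"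
      using that p1 by (simp add: coprime_iff_gcd_eq_1 gcd.commute)
    then have cop: "coprime (nat (k mod int p)) p" by (simp only: coprime_int_iff)
    moreover have "nat (k mod int p) \<noteq> 0" using cop p1 by (intro notI) auto
    moreover have "nat (k mod int p) \<le> p"
      using p1 pos_mod_bound[of "int p" k] by linarith
    ultimately have "nat (k mod int p) \<in> totatives p" by (auto simp: totatives_def)
    then obtain t where "nat (k mod int p) = g ^ t mod p"
      using residue_primroot_is_generator[OF p1 g] by (auto simp: bij_betw_def)
    then have "int (nat (k mod int p)) = int (g ^ t mod p)" by simp
    then have "k mod int p = int g ^ t mod int p"
      using p1 by (simp add: zmod_int)
    then show ?thesis by (auto simp: cong_iff_mod_eq)
  qed
  define dlog where "dlog k = (SOME t. [k = int g ^ t] (mod int p))" for k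
  have dlog: "[k = int g ^ dlog k] (mod int p)" if "coprime k (int p)" for k
    unfolding dlog_def using gen[OF that] by (rule someI_ex)
  have copg': "coprime (int g ^ t) (int p)" for t
    using copg by (simp add: coprime_commute)
  have half: "[int g ^ (3 * n) = - 1] (mod int p)"
  proof -
    have "[int g ^ (6 * n) = int g ^ 0] (mod int p)"
      unfolding expo by (simp add: cong_iff_mod_eq)
    moreover have "int g ^ (6 * n) - 1 = (int g ^ (3 * n) - 1) * (int g ^ (3 * n) + 1)"
      by (simp add: algebra_simps flip: power_add)
    moreover have "\<not> [int g ^ (3 * n) = int g ^ 0] (mod int p)"
      unfolding expo using n0 by (simp add: cong_iff_mod_eq)
    ultimately show ?thesis
      using assms(1) by (simp add: prime_dvd_mult_iff cong_iff_dvd_diff)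
  qed
  have cube: "[int g ^ (3 * s) = int g ^ (3 * t)] (mod int p) \<longleftrightarrow> s mod (2 * n) = t mod (2 * n)" for s t
  proof -
    have "3 * s mod (6 * n) = 3 * (s mod (2 * n))" for s
      using mult_mod_right[of 3 s "2 * n"] by simp
    then show ?thesis
      by (simp only: expo cong_iff_mod_eq[of "3 * s"] mult_cancel1) simp
  qed
  have X_iff: "\<psi> \<in> X \<longleftrightarrow> dirichlet_character p \<psi> \<and> \<psi> (- 1) = - 1 \<and> \<psi> a = 1" for \<psi>
  proof (cases "dirichlet_character p \<psi>")
    case True
    have "[- 1 - a = a ^ 2] (mod int p)"
      unfolding cong_iff_dvd_diff by (rule dvdI[of _ _ "- 1"]) (simp add: assms(3))
    then have "\<psi> (- 1 - a) = \<psi> a ^ 2"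
      using character_cong[OF p1 True] character_power[OF p1 True] by metis
    then show ?thesis
      using True character_mod[OF p1 True] character_1[OF p1 True]
      by (auto simp: X_def odd_chars_trivial_on_def)
  qed (simp add: X_def odd_chars_trivial_on_def)
  have "coprime a (int p)"
    unfolding assms(3) coprime_iff_gcd_eq_1 using gcd_add_mult[of a "a + 1" 1]
    by (simp add: power2_eq_square algebra_simps)
  from gen[OF this] obtain s where s: "[a = int g ^ s] (mod int p)" by auto
  have "[a ^ 3 = 1] (mod int p)" using cube_roots_mod_prime[OF assms(1,3), of a] by simp
  then have "[int g ^ (3 * s) = int g ^ (3 * 0)] (mod int p)"
    using cong_pow[OF s, of 3] by (simp add: cong_sym_eq power_mult[symmetric] mult.commute) (meson cong_sym cong_trans)
  then have "2 * n dvd s" unfolding cube by auto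
  then obtain u where u: "s = 2 * n * u" by auto
  \<comment> \<open>Otherwise \<open>a\<close> would be 1 modulo \<open>p\<close>, and (a - 1)(a +
    2) = p - 3 would force \<open>p\<close> to divide 3.\<close>
  have u3: "\<not> 3 dvd u"
  proof
    assume "3 dvd u"
    then obtain v where "u = 3 * v" by auto
    then have "[int g ^ s = int g ^ 0] (mod int p)"
      unfolding expo u by (simp add: cong_iff_mod_eq)
    then have "[a = 1] (mod int p)" using s by (auto intro: cong_trans)
    then have "int p dvd (a - 1) * (a + 2)" by (simp add: cong_iff_dvd_diff)
    moreover have "(a - 1) * (a + 2) = int p - 3" unfolding assms(3) by (simp add: algebra_simps power2_eq_square)
    ultimately have "int p dvd 3" by (metis dvd_diff_commute dvd_minus_self dvd_refl dvd_diffD1 dvd_diff_right_iff)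
    then have "int p \<le> 3" by (rule zdvd_imp_le) simp
    with assms(2) n0 show False by simp
  qed
  let ?Z = "{z. z ^ n = (- 1 :: complex)}"
  \<comment> \<open>\<open>\<phi> z\<close> is the character that sends \<open>g\<close> to
    \<open>z\<close>. The choice in \<open>dlog\<close> is irrelevant: exponents are determined
    modulo \<open>6 * n\<close>, and \<open>z ^ (6 * n) = 1\<close>.\<close>
  define \<phi> where "\<phi> z k = (if coprime k (int p) then z ^ dlog k else (0 :: complex))" for z k
  have \<phi>: "\<phi> z k = z ^ t" if z: "z \<in> ?Z" and k: "[k = int g ^ t] (mod int p)" for z k t
  proof -
    have cop: "coprime k (int p)" using k copg' cong_imp_coprime cong_sym by blast
    then have "[dlog k = t] (mod 6 * n)"
      using dlog[OF cop] k expo cong_sym cong_trans by blast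
    moreover have "z ^ i = z ^ (i mod (6 * n))" for i
    proof -
      have "z ^ i = z ^ (6 * n * (i div (6 * n)) + i mod (6 * n))" by simp
      also have "\<dots> = ((z ^ n) ^ 6) ^ (i div (6 * n)) * z ^ (i mod (6 * n))"
        by (simp only: power_add power_mult mult.commute[of 6 n])
      finally show ?thesis using z by simp
    qed
    ultimately show ?thesis
      using cop by (metis \<phi>_def cong_iff_mod_eq)
  qed
  have bij: "bij_betw (\<lambda>\<psi>. \<psi> (int g)) X ?Z"
  proof (rule bij_betw_byWitness[where f' = \<phi>])
    have g1: "[int g = int g ^ 1] (mod int p)" by simp
    show "\<forall>z\<in>?Z. \<phi> z (int g) = z" using \<phi>[OF _ g1] by simp
    show "\<forall>\<psi>\<in>X. \<phi> (\<psi> (int g)) = \<psi>"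
    proof
      fix \<psi> assume "\<psi> \<in> X"
      then have dc: "dirichlet_character p \<psi>" by (simp add: X_iff)
      show "\<phi> (\<psi> (int g)) = \<psi>"
      proof
        fix k show "\<phi> (\<psi> (int g)) k = \<psi> k"
          using character_cong[OF p1 dc dlog[of k]] character_power[OF p1 dc] character_eq_0_iff[OF p1 dc, of k]
          by (auto simp: \<phi>_def)
      qed
    qed
    show "(\<lambda>\<psi>. \<psi> (int g)) ` X \<subseteq> ?Z"
    proof clarify
      fix \<psi> assume X: "\<psi> \<in> X"
      then have dc: "dirichlet_character p \<psi>" by (simp add: X_iff)
      \<comment> \<open>\<open>w\<close> is a cube root of unity with \<open>w ^ u = 1\<close> and 3
        not dividing \<open>u\<close>, hence \<open>w = 1\<close>; dividing the value -1 at exponent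
        \<open>3 * n\<close> by \<open>w\<close> leaves exponent \<open>n\<close>.\<close>
      define w where "w = \<psi> (int g) ^ (2 * n)"
      have "\<psi> (int g) ^ (3 * n) = - 1"
        using character_cong[OF p1 dc half] character_power[OF p1 dc] X by (simp add: X_iff)
      then have h: "w * \<psi> (int g) ^ n = - 1" by (simp add: w_def flip: power_add)
      have "w ^ 3 = (\<psi> (int g) ^ (3 * n)) ^ 2" by (simp add: w_def mult.commute flip: power_mult)
      then have w3: "w ^ 3 = 1" using \<open>_ ^ (3 * n) = - 1\<close> by simp
      have wu: "w ^ u = 1"
        using character_cong[OF p1 dc s] character_power[OF p1 dc] X by (simp add: X_iff w_def u power_mult)
      have "w ^ u = (w ^ 3) ^ (u div 3) * w ^ (u mod 3)"
        by (simp flip: power_mult power_add)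
      then have "w ^ (u mod 3) = 1" using w3 wu by simp
      moreover have "u mod 3 = 1 \<or> u mod 3 = 2" using u3 by presburger
      ultimately have "w = 1 \<or> w ^ 2 = 1" by auto
      then have "w = 1"
      proof
        assume "w ^ 2 = 1"
        moreover have "w ^ 3 = w ^ 2 * w" by (simp add: power2_eq_square power3_eq_cube)
        ultimately show "w = 1" using w3 by simp
      qed
      with h show "\<psi> (int g) ^ n = - 1" by simp
    qed
    show "\<phi> ` ?Z \<subseteq> X"
    proof clarify
      fix z :: complex assume zn: "z ^ n = - 1"
      then have z: "z \<in> ?Z" "z \<noteq> 0" using n0 by (auto simp: power_0_left)
      have "\<phi> z (k * l) = \<phi> z k * \<phi> z l" for k l
      proof (cases "coprime k (int p) \<and> coprime l (int p)")
        case True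
        then have "[k * l = int g ^ (dlog k + dlog l)] (mod int p)"
          using dlog[of k] dlog[of l] cong_mult by (simp add: power_add)
        from \<phi>[OF z(1) this] show ?thesis using True by (simp add: \<phi>_def[of _ k] \<phi>_def[of _ l] power_add)
      qed (auto simp: \<phi>_def)
      moreover have "\<phi> z (k + int p) = \<phi> z k" for k
      proof (cases "coprime k (int p)")
        case True
        from dlog[OF this] have "[k + int p = int g ^ dlog k] (mod int p)"
          by (simp add: cong_iff_mod_eq)
        from \<phi>[OF z(1) this] show ?thesis using True by (simp add: \<phi>_def[of _ k])
      next
        case False
        then show ?thesis by (simp add: \<phi>_def coprime_iff_gcd_eq_1)
      qed
      moreover have "\<phi> z k \<noteq> 0 \<longleftrightarrow> coprime k (int p)" for k
        using z(2) by (simp add: \<phi>_def)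
      moreover have "\<phi> z (- 1) = - 1"
        using \<phi>[OF z(1) cong_sym[OF half]] zn by (simp add: power_mult mult.commute[of 3 n])
      moreover have "\<phi> z a = 1"
        using \<phi>[OF z(1) s] zn by (simp add: u power_mult mult.commute[of 2 n])
      ultimately show "\<phi> z \<in> X" by (auto simp: X_iff dirichlet_character_def)
    qed
  qed
  have card: "card X = n"
    using bij_betw_same_card[OF bij] card_nth_roots[of "- 1" n] n0 by simp
  show "card X > 0" using card n0 by simp
  show "(\<Sum>\<psi>\<in>X. \<psi> m) = of_nat (card X) * (of_bool [m ^ 3 = 1] (mod int p) - of_bool [m ^ 3 = - 1] (mod int p))"
  proof (cases "coprime m (int p)")
    case True
    from gen[OF this] obtain t where t: "[m = int g ^ t] (mod int p)" by auto
    have m3: "[m ^ 3 = int g ^ (3 * t)] (mod int p)"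
      using cong_pow[OF t, of 3] by (simp add: mult.commute flip: power_mult)
    have 1: "[m ^ 3 = 1] (mod int p) \<longleftrightarrow> t mod (2 * n) = 0"
      using cube[of t 0] m3 by (simp add: cong_iff_mod_eq)
    \<comment> \<open>-1 is read as \<open>g ^ (3 * n)\<close>, the cube of \<open>g ^ n\<close>, so
      that \<open>cube\<close> compares \<open>t\<close> with \<open>n\<close>.\<close>
    have 2: "[m ^ 3 = - 1] (mod int p) \<longleftrightarrow> t mod (2 * n) = n"
      using cube[of t n] m3 half n0 by (simp add: cong_iff_mod_eq)
    have "(\<Sum>\<psi>\<in>X. \<psi> m) = (\<Sum>\<psi>\<in>X. \<psi> (int g) ^ t)"
    proof (intro sum.cong refl)
      fix \<psi> assume "\<psi> \<in> X"
      then have dc: "dirichlet_character p \<psi>" by (simp add: X_iff)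
      show "\<psi> m = \<psi> (int g) ^ t"
        using character_cong[OF p1 dc t] character_power[OF p1 dc] by simp
    qed
    also have "\<dots> = (\<Sum>z\<in>?Z. z ^ t)"
      by (rule sum.reindex_bij_betw[OF bij])
    also have "\<dots> = (if n dvd t then (- 1) ^ (t div n) * of_nat n else 0)"
      by (rule sum_power_roots[OF n0])
    also have "\<dots> = of_nat n * (of_bool (t mod (2 * n) = 0) - of_bool (t mod (2 * n) = n))"
    proof (cases "n dvd t")
      case True
      then obtain v where v: "t = n * v" by auto
      have "t mod (2 * n) = n * (v mod 2)"
        unfolding v using mult_mod_right[of n v 2] by (simp add: mult.commute)
      then show ?thesis using n0 v by (cases "even v") (auto simp: odd_iff_mod_2_eq_one)
    next
      case False
      then have "t mod (2 * n) \<noteq> 0" "t mod (2 * n) \<noteq> n"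
        by (metis dvd_mod_iff dvd_triv_right dvd_0_right dvd_refl)+
      with False show ?thesis by simp
    qed
    finally show ?thesis by (simp add: card 1 2)
  next
    case False
    then have "(\<Sum>\<psi>\<in>X. \<psi> m) = 0"
      using character_eq_0_iff[OF p1] by (intro sum.neutral) (simp add: X_iff)
    moreover have "\<not> [m ^ 3 = 1] (mod int p)" "\<not> [m ^ 3 = - 1] (mod int p)"
      using False cong_imp_coprime[of _ "m ^ 3" "int p"] cong_sym[of "m ^ 3" _ "int p"]
      by (metis coprime_1_left coprime_minus_left_iff coprime_power_left_iff zero_neq_numeral)+
    ultimately show ?thesis by simp
  qed
qed

section \<open>Mean squares\<close>

text \<open>By complete multiplicativity the terms at multiples of \<open>q\<close> form the whole
  series times \<open>\<psi>(q)/q\<close>. The reindexing keeps the order of the terms, so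
  conditional convergence is enough.\<close>

lemma sums_Euler_factor:
  fixes \<psi> :: "int \<Rightarrow> complex" and q :: nat
  assumes mult: "\<And>k l. \<psi> (k * l) = \<psi> k * \<psi> l" and "q > 0"
    and sums: "(\<lambda>n. \<psi> (int n) / of_nat n) sums L"
  shows "(\<lambda>n. (if q dvd n then 0 else \<psi> (int n)) / of_nat n) sums ((1 - \<psi> (int q) / of_nat q) * L)"
proof -
  define f where "f n = (if q dvd n then \<psi> (int n) / of_nat n else 0)" for n
  have "(\<lambda>n. f (q * n)) = (\<lambda>n. \<psi> (int q) / of_nat q * (\<psi> (int n) / of_nat n))"
    by (simp add: f_def mult)
  moreover have "\<dots> sums (\<psi> (int q) / of_nat q * L)"
    using sums by (rule sums_mult)
  moreover have "strict_mono (\<lambda>n. q * n)" using \<open>q > 0\<close> by (simp add: strict_mono_def)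
  moreover have "f n = 0" if "n \<notin> range (\<lambda>n. q * n)" for n
    using that by (auto simp: f_def elim!: dvdE)
  ultimately have "f sums (\<psi> (int q) / of_nat q * L)"
    using sums_mono_reindex[of "\<lambda>n. q * n" f] by simp
  from sums_diff[OF sums this]
  have "(\<lambda>n. \<psi> (int n) / of_nat n - f n) sums ((1 - \<psi> (int q) / of_nat q) * L)"
    by (simp add: algebra_simps)
  moreover have "(\<lambda>n. \<psi> (int n) / of_nat n - f n) = (\<lambda>n. (if q dvd n then 0 else \<psi> (int n)) / of_nat n)"
    by (auto simp: f_def)
  ultimately show ?thesis by simp
qed

text \<open>The term at \<open>n = 0\<close> is a division by zero and hence 0, so the index shift
  in \<open>L_at_1\<close> changes nothing.\<close>

lemma L_at_1_eqI:
  assumes "(\<lambda>n. \<psi> (int n) / of_nat n) sums L"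
  shows "L_at_1 \<psi> = L"
  using assms sums_Suc_iff[of "\<lambda>n. \<psi> (int n) / of_nat n" L]
  by (simp add: L_at_1_def sums_iff)

section \<open>Averages over the odd characters trivial on the cubic subgroup\<close>

context
  fixes p n :: nat and a :: int
  assumes prime: "prime p" and pn: "p = 6 * n + 1" and pa: "int p = a\<^sup>2 + a + 1"
    and card3: "card {1, a mod int p, (- 1 - a) mod int p} = 3"
begin

definition odd_chars where
  "odd_chars = odd_chars_trivial_on p {1, a mod int p, (- 1 - a) mod int p}"

text \<open>The closed form of L(1,psi) given by \<open>sums_odd_periodic\<close>, indexed by
  integers so that residue substitutions apply.\<close>

definition L_value where
  "L_value \<psi> = complex_of_real (pi / (2 * p)) * (\<Sum>k\<in>{0..<int p}. \<psi> k * of_real (cot (pi * of_int k / p)))"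

lemma p_gt_1: "p > 1" using prime prime_gt_1_nat by auto

lemma
  assumes "\<psi> \<in> odd_chars"
  shows character: "dirichlet_character p \<psi>" and character_minus_1: "\<psi> (- 1) = - 1"
  using assms by (auto simp: odd_chars_def odd_chars_trivial_on_def)

lemmas char_mult = character_mult[OF p_gt_1 character]
lemmas char_eq_0_iff = character_eq_0_iff[OF p_gt_1 character]
lemmas char_mod = character_mod[OF p_gt_1 character]
lemmas char_norm = norm_character[OF p_gt_1 character]

lemma sums_L_value:
  assumes X: "\<psi> \<in> odd_chars"
  shows "(\<lambda>n. \<psi> (int n) / of_nat n) sums L_value \<psi>"
proof -
  have "\<psi> (- k) = - \<psi> k" for k
    using char_mult[OF X, of "- 1" k] character_minus_1[OF X] by simp
  then show ?thesis
    using sums_odd_periodic[of p \<psi>] p_gt_1 character_add[OF p_gt_1 character[OF X]]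
    by (simp add: L_value_def sum_int_conv_nat)
qed

text \<open>In the double sum for |L|^2 the index of the conjugate factor is written as
  \<open>c * k * j\<close>; then only \<open>cnj (\<psi> j)\<close> depends on the character, and
  its coefficient is \<open>cot_sum (c * j) p\<close>. Orthogonality restricts \<open>j\<close> to H
  and -H.\<close>

lemma sum_chars_mean_square:
  assumes c: "coprime c (int p)"
  shows "(\<Sum>\<psi>\<in>odd_chars. \<psi> c * of_real ((cmod (L_value \<psi>))\<^sup>2))
    = of_real (card odd_chars * (2 * pi\<^sup>2 / p) * dedekind_sum3 a c p)"
proof -
  define K where "K k = cot (pi * of_int k / p)" for k :: int
  have p: "int p > 0" using p_gt_1 by simp
  have K0: "K 0 = 0" by (simp add: K_def cot_def)
  have Kmod: "K (k mod int p) = K k" for k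
  proof -
    have "real_of_int k = real_of_int (k mod int p + int p * (k div int p))" by simp
    also have "\<dots> = real_of_int (k mod int p) + real p * real_of_int (k div int p)"
      by (simp only: of_int_add of_int_mult of_int_of_nat_eq)
    finally have "pi * of_int k / p = pi * of_int (k mod int p) / p + of_int (k div int p) * pi"
      using p by (simp add: field_simps)
    then show ?thesis by (simp add: K_def cot_altdef)
  qed
  \<comment> \<open>Substitution \<open>l = c * k * j\<close>: the values at \<open>c\<close> and
    \<open>k\<close> meet their conjugates and give 1. For \<open>k = 0\<close> both sides vanish
    because \<open>K 0 = 0\<close>.\<close>
  have inner: "\<psi> c * \<psi> k * K k * (\<Sum>l\<in>{0..<int p}. cnj (\<psi> l) * K l)
      = (\<Sum>j\<in>{0..<int p}. K k * K (c * j * k) * cnj (\<psi> j))"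
    if X: "\<psi> \<in> odd_chars" and k: "k \<in> {0..<int p}" for \<psi> :: "int \<Rightarrow> complex" and k
  proof (cases "k = 0")
    case False
    with k have "\<not> int p dvd k" by (auto dest: zdvd_imp_le)
    with prime have "coprime (int p) k" by (intro prime_imp_coprime) auto
    then have copk: "coprime k (int p)" by (simp add: coprime_commute)
    with c have "coprime (c * k) (int p)" by simp
    then have "(\<Sum>l\<in>{0..<int p}. cnj (\<psi> l) * K l) = (\<Sum>j\<in>{0..<int p}. cnj (\<psi> (c * k * j)) * K (c * k * j))"
      using sum_residues_mult[of "int p" "c * k" "\<lambda>l. cnj (\<psi> l) * K l"] p
      by (simp add: Kmod char_mod[OF X])
    also have "\<psi> c * \<psi> k * K k * \<dots> = (\<Sum>j\<in>{0..<int p}. (\<psi> c * cnj (\<psi> c)) * (\<psi> k * cnj (\<psi> k)) * (K k * K (c * j * k) * cnj (\<psi> j)))"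
      by (simp add: sum_distrib_left char_mult[OF X] mult_ac)
    moreover have "\<psi> c * cnj (\<psi> c) = 1" "\<psi> k * cnj (\<psi> k) = 1"
      using char_norm[OF X c] char_norm[OF X copk] by (simp_all add: complex_norm_square[symmetric])
    ultimately show ?thesis by simp
  qed (simp add: K0)
  have "(\<Sum>\<psi>\<in>odd_chars. \<psi> c * of_real ((cmod (L_value \<psi>))\<^sup>2))
     = (\<Sum>\<psi>\<in>odd_chars. of_real ((pi / (2 * p))\<^sup>2) * (\<Sum>k\<in>{0..<int p}. \<Sum>j\<in>{0..<int p}. K k * K (c * j * k) * cnj (\<psi> j)))"
  proof (intro sum.cong refl)
    fix \<psi> assume X: "\<psi> \<in> odd_chars"
    define S where "S = (\<Sum>l\<in>{0..<int p}. cnj (\<psi> l) * K l)"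
    have "of_real ((cmod (L_value \<psi>))\<^sup>2) = L_value \<psi> * cnj (L_value \<psi>)" by (rule complex_norm_square)
    also have "\<dots> = of_real ((pi / (2 * p))\<^sup>2) * ((\<Sum>k\<in>{0..<int p}. \<psi> k * K k) * S)"
      by (simp add: L_value_def K_def S_def power2_eq_square mult_ac)
    finally have "\<psi> c * of_real ((cmod (L_value \<psi>))\<^sup>2) = of_real ((pi / (2 * p))\<^sup>2) *
        (\<Sum>k\<in>{0..<int p}. \<psi> c * \<psi> k * K k * S)"
      by (simp add: sum_distrib_left sum_distrib_right mult_ac)
    then show "\<psi> c * of_real ((cmod (L_value \<psi>))\<^sup>2) = of_real ((pi / (2 * p))\<^sup>2) *
        (\<Sum>k\<in>{0..<int p}. \<Sum>j\<in>{0..<int p}. K k * K (c * j * k) * cnj (\<psi> j))"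
      using inner[OF X] by (simp add: S_def)
  qed
  also have "\<dots> = of_real ((pi / (2 * p))\<^sup>2) *
      (\<Sum>j\<in>{0..<int p}. cnj (\<Sum>\<psi>\<in>odd_chars. \<psi> j) * of_real (\<Sum>k\<in>{0..<int p}. K k * K (c * j * k)))"
    unfolding sum_distrib_left[symmetric]
    by (subst sum.swap, subst (2) sum.swap, subst sum.swap)
      (simp add: sum_distrib_left sum_distrib_right mult_ac)
  also have "(\<Sum>j\<in>{0..<int p}. cnj (\<Sum>\<psi>\<in>odd_chars. \<psi> j) * of_real (\<Sum>k\<in>{0..<int p}. K k * K (c * j * k)))
     = of_real (real (card odd_chars) * 4 * real p * (\<Sum>j\<in>{0..<int p}. of_bool [j ^ 3 = 1] (mod int p) * dedekind_sum (c * j) p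
          - of_bool [j ^ 3 = - 1] (mod int p) * dedekind_sum (c * j) p))"
  proof -
    have "cnj (\<Sum>\<psi>\<in>odd_chars. \<psi> j) * of_real (\<Sum>k\<in>{0..<int p}. K k * K (c * j * k))
      = of_real (real (card odd_chars) * 4 * real p * (of_bool [j ^ 3 = 1] (mod int p) * dedekind_sum (c * j) p
          - of_bool [j ^ 3 = - 1] (mod int p) * dedekind_sum (c * j) p))" for j
    proof (cases "coprime j (int p)")
      case True
      have orth: "(\<Sum>\<psi>\<in>odd_chars. \<psi> j) =
          of_real (real (card odd_chars) * (of_bool [j ^ 3 = 1] (mod int p) - of_bool [j ^ 3 = - 1] (mod int p)))"
        by (subst odd_chars_orthogonality(2)[OF prime pn pa, of j, folded odd_chars_def]) (simp add: of_bool_def)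
      have "(\<Sum>k\<in>{0..<int p}. K k * K (c * j * k)) = cot_sum (c * j) (int p)"
        by (simp add: cot_sum_def K_def)
      also have "\<dots> = 4 * real p * dedekind_sum (c * j) p"
        using cot_sum_eq_dedekind_sum[OF p, of "c * j"] True c by simp
      finally have cot: "(\<Sum>k\<in>{0..<int p}. K k * K (c * j * k)) = 4 * real p * dedekind_sum (c * j) p" .
      show ?thesis unfolding orth cot complex_cnj_complex_of_real of_real_mult[symmetric] of_real_eq_iff
        by (simp only: algebra_simps of_int_of_nat_eq)
    next
      case False
      then have "\<not> [j ^ 3 = 1] (mod int p)" "\<not> [j ^ 3 = - 1] (mod int p)"
        using cong_imp_coprime[of _ "j ^ 3" "int p"] cong_sym[of "j ^ 3" _ "int p"]
        by (metis coprime_1_left coprime_minus_left_iff coprime_power_left_iff zero_neq_numeral)+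
      moreover have "(\<Sum>\<psi>\<in>odd_chars. \<psi> j) = 0"
        using False char_eq_0_iff by (intro sum.neutral) auto
      ultimately show ?thesis by simp
    qed
    then show ?thesis by (simp add: sum_distrib_left)
  qed
  also have "(\<Sum>j\<in>{0..<int p}. of_bool [j ^ 3 = 1] (mod int p) * dedekind_sum (c * j) p
          - of_bool [j ^ 3 = - 1] (mod int p) * dedekind_sum (c * j) p) = 2 * dedekind_sum3 a c p"
  proof -
    let ?f = "\<lambda>j. of_bool [j ^ 3 = 1] (mod int p) * dedekind_sum (c * j) p"
    have fmod: "?f (j mod int p) = ?f j" for j
    proof -
      have "[(j mod int p) ^ 3 = 1] (mod int p) \<longleftrightarrow> [j ^ 3 = 1] (mod int p)"
        by (simp add: cong_iff_mod_eq power_mod)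
      moreover have "dedekind_sum (c * (j mod int p)) p = dedekind_sum (c * j) p"
        by (rule dedekind_sum_cong) (simp add: cong_iff_mod_eq mod_mult_right_eq)
      ultimately show ?thesis by simp
    qed
    \<comment> \<open>Replacing \<open>j\<close> by \<open>- j\<close> shows that -H contributes the
      same as H, since the Dedekind sum is odd; this is the source of the factor 2.\<close>
    have "(\<Sum>j\<in>{0..<int p}. ?f j) = (\<Sum>j\<in>{0..<int p}. ?f ((- 1) * j))"
      using sum_residues_mult[of "int p" "- 1" ?f] p fmod by simp
    also have "\<dots> = - (\<Sum>j\<in>{0..<int p}. of_bool [j ^ 3 = - 1] (mod int p) * dedekind_sum (c * j) p)"
    proof -
      have "[(- j) ^ 3 = 1] (mod int p) \<longleftrightarrow> [j ^ 3 = - 1] (mod int p)" for j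
        using cong_minus_minus_iff[of "j ^ 3" "- 1" "int p"] by simp
      then show ?thesis by (simp add: dedekind_sum_minus sum_negf)
    qed
    finally have "(\<Sum>j\<in>{0..<int p}. ?f j - of_bool [j ^ 3 = - 1] (mod int p) * dedekind_sum (c * j) p)
        = 2 * (\<Sum>j\<in>{0..<int p}. ?f j)"
      by (simp add: sum_subtractf)
    also have "(\<Sum>j\<in>{0..<int p}. ?f j) = (\<Sum>j\<in>{1, a mod int p, (- 1 - a) mod int p}. ?f j)"
    proof (rule sum.mono_neutral_right)
      show "{1, a mod int p, (- 1 - a) mod int p} \<subseteq> {0..<int p}" using p p_gt_1 by auto
      show "\<forall>j\<in>{0..<int p} - {1, a mod int p, (- 1 - a) mod int p}. ?f j = 0"
        using cube_roots_mod_prime[OF prime pa] p_gt_1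
        by (auto simp: cong_iff_mod_eq)
    qed simp
    also have "\<dots> = (\<Sum>j\<in>{1, a mod int p, (- 1 - a) mod int p}. dedekind_sum (c * j) p)"
    proof (intro sum.cong refl)
      fix j assume "j \<in> {1, a mod int p, (- 1 - a) mod int p}"
      then have "[j ^ 3 = 1] (mod int p)"
        unfolding cube_roots_mod_prime[OF prime pa] by (auto simp: cong_iff_mod_eq)
      then show "?f j = dedekind_sum (c * j) p" by simp
    qed
    also have "\<dots> = dedekind_sum3 a c p"
    proof -
      \<comment> \<open>Distinctness keeps the sum over the set from merging terms; the
        representative \<open>- 1 - a\<close> of the square of \<open>a\<close> causes the minus
        sign in \<open>dedekind_sum3\<close>.\<close>
      have "distinct [1, a mod int p, (- 1 - a) mod int p]"
        using card3 by (intro card_distinct) simp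
      moreover have "dedekind_sum (c * (a mod int p)) p = dedekind_sum (c * a) p"
         "dedekind_sum (c * ((- 1 - a) mod int p)) p = dedekind_sum (- (c * (a + 1))) p"
        by (rule dedekind_sum_cong, simp add: cong_iff_mod_eq mod_mult_right_eq algebra_simps)+
      ultimately show ?thesis
        by (simp add: dedekind_sum3_def dedekind_sum_minus)
    qed
    finally show ?thesis .
  qed
  finally show ?thesis
    using p_gt_1 by (simp add: power2_eq_square field_simps)
qed

lemma L_induced_2:
  assumes X: "\<psi> \<in> odd_chars"
  shows "L_at_1 (induced_character (2 * p) \<psi>) = (1 - \<psi> 2 / 2) * L_value \<psi>"
proof (rule L_at_1_eqI)
  have "induced_character (2 * p) \<psi> (int n) = (if 2 dvd n then 0 else \<psi> (int n))" for n
    using char_eq_0_iff[OF X, of "int n"] by (auto simp: induced_character_def)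
  then show "(\<lambda>n. induced_character (2 * p) \<psi> (int n) / of_nat n) sums ((1 - \<psi> 2 / 2) * L_value \<psi>)"
    using sums_Euler_factor[OF char_mult[OF X] _ sums_L_value[OF X], of 2] by simp
qed

lemma L_induced_6:
  assumes X: "\<psi> \<in> odd_chars"
  shows "L_at_1 (induced_character (6 * p) \<psi>) = (1 - \<psi> 3 / 3) * ((1 - \<psi> 2 / 2) * L_value \<psi>)"
proof (rule L_at_1_eqI)
  \<comment> \<open>Removing the even terms leaves a completely multiplicative function with the
    same value at 3, so the factor at 3 can be split off next.\<close>
  define \<psi>' where "\<psi>' k = (if 2 dvd k then 0 else \<psi> k)" for k :: int
  have "(\<lambda>n. \<psi>' (int n) / of_nat n) sums ((1 - \<psi> 2 / 2) * L_value \<psi>)"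
    using sums_Euler_factor[OF char_mult[OF X] _ sums_L_value[OF X], of 2] by (simp add: \<psi>'_def)
  moreover have "\<psi>' (k * l) = \<psi>' k * \<psi>' l" for k l
    by (simp add: \<psi>'_def char_mult[OF X])
  ultimately have "(\<lambda>n. (if 3 dvd n then 0 else \<psi>' (int n)) / of_nat n) sums
      ((1 - \<psi>' (int 3) / of_nat 3) * ((1 - \<psi> 2 / 2) * L_value \<psi>))"
    by (intro sums_Euler_factor) auto
  moreover have "induced_character (6 * p) \<psi> (int n) = (if 3 dvd n then 0 else \<psi>' (int n))" for n
  proof -
    have "coprime n 3 \<longleftrightarrow> \<not> 3 dvd n"
      using prime_imp_coprime[of 3 n] by (auto simp: coprime_commute dest: coprime_common_divisor)
    moreover have "6 * p = 2 * (3 * p)" by simp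
    ultimately have "coprime n (6 * p) \<longleftrightarrow> \<not> 2 dvd n \<and> \<not> 3 dvd n \<and> coprime n p"
      by (simp only: coprime_mult_right_iff coprime_right_2_iff_odd)
    then show ?thesis
      using char_eq_0_iff[OF X, of "int n"] by (auto simp: induced_character_def \<psi>'_def simp flip: of_nat_mult)
  qed
  ultimately show "(\<lambda>n. induced_character (6 * p) \<psi> (int n) / of_nat n) sums
      ((1 - \<psi> 3 / 3) * ((1 - \<psi> 2 / 2) * L_value \<psi>))"
    by (simp add: \<psi>'_def)
qed

lemma sum_Re_chars_mean_square:
  assumes "coprime c (int p)"
  shows "(\<Sum>\<psi>\<in>odd_chars. Re (\<psi> c) * (cmod (L_value \<psi>))\<^sup>2) = card odd_chars * (2 * pi\<^sup>2 / p) * dedekind_sum3 a c p"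
proof -
  have "(\<Sum>\<psi>\<in>odd_chars. Re (\<psi> c) * (cmod (L_value \<psi>))\<^sup>2) = Re (\<Sum>\<psi>\<in>odd_chars. \<psi> c * of_real ((cmod (L_value \<psi>))\<^sup>2))"
    by (simp del: of_real_power)
  also have "\<dots> = card odd_chars * (2 * pi\<^sup>2 / p) * dedekind_sum3 a c p"
    unfolding sum_chars_mean_square[OF assms] by (simp only: Re_complex_of_real)
  finally show ?thesis .
qed

lemma coprime_p: "coprime 2 (int p)" "coprime 3 (int p)" "coprime 6 (int p)"
proof -
  show 6: "coprime 6 (int p)"
    using gcd_add_mult[of 6 "int n" 1] unfolding pn by (simp add: coprime_iff_gcd_eq_1 mult.commute add.commute)
  then have "coprime (2 * 3) (int p)" by simp
  then show "coprime 2 (int p)" "coprime 3 (int p)" by (simp_all only: coprime_mult_left_iff)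
qed

lemma cmod_Euler_factor:
  assumes "cmod z = 1"
  shows "(cmod (1 - z / of_nat q))\<^sup>2 = 1 + 1 / (real q)\<^sup>2 - 2 / real q * Re z"
proof -
  have "(Re z)\<^sup>2 + (Im z)\<^sup>2 = 1" using assms by (simp add: cmod_power2[symmetric])
  then have "(Re z / q)\<^sup>2 + (Im z / q)\<^sup>2 = 1 / (real q)\<^sup>2"
    by (simp add: power_divide add_divide_distrib[symmetric])
  then show ?thesis by (simp add: cmod_power2 power2_diff)
qed

text \<open>The squared Euler factor at 2 is \<open>5 / 4 - Re (\<psi> 2)\<close>, and
  \<open>5 / 4\<close> is carried by the weight \<open>c = 1\<close>.\<close>

lemma mean_square_L_2:
  "mean_square_L 2 p {1, a mod int p, (- 1 - a) mod int p}
     = 2 * pi\<^sup>2 / p * (5 / 4 * dedekind_sum3 a 1 p - dedekind_sum3 a 2 p)"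
proof -
  let ?S = "\<lambda>c. \<Sum>\<psi>\<in>odd_chars. Re (\<psi> c) * (cmod (L_value \<psi>))\<^sup>2"
  have "(cmod (L_at_1 (induced_character (2 * p) \<psi>)))\<^sup>2
      = 5 / 4 * (Re (\<psi> 1) * (cmod (L_value \<psi>))\<^sup>2) - Re (\<psi> 2) * (cmod (L_value \<psi>))\<^sup>2" if X: "\<psi> \<in> odd_chars" for \<psi>
  proof -
    have "(cmod (L_at_1 (induced_character (2 * p) \<psi>)))\<^sup>2 = (5 / 4 - Re (\<psi> 2)) * (cmod (L_value \<psi>))\<^sup>2"
      using cmod_Euler_factor[OF char_norm[OF X coprime_p(1)], of 2]
      by (simp add: L_induced_2[OF X] norm_mult power_mult_distrib)
    then show ?thesis
      using character_1[OF p_gt_1 character[OF X]] by (simp add: left_diff_distrib)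
  qed
  then have "(\<Sum>\<psi>\<in>odd_chars. (cmod (L_at_1 (induced_character (2 * p) \<psi>)))\<^sup>2) = 5 / 4 * ?S 1 - ?S 2"
    by (simp add: sum_subtractf sum_distrib_left)
  also have "\<dots> = card odd_chars * (2 * pi\<^sup>2 / p * (5 / 4 * dedekind_sum3 a 1 p - dedekind_sum3 a 2 p))"
    using sum_Re_chars_mean_square[of 1] sum_Re_chars_mean_square[OF coprime_p(1)]
    by (simp add: algebra_simps)
  finally show ?thesis
    using odd_chars_orthogonality(1)[OF prime pn pa, folded odd_chars_def]
    by (simp add: mean_square_L_def odd_chars_def[symmetric])
qed

text \<open>The coefficients come from expanding (10/9 - (2/3) Re psi(3)) (5/4 - Re psi(2)). The
  product of real parts is half of \<open>Re (\<psi> 6) + Re (\<psi> m)\<close>, because the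
  conjugate of \<open>\<psi> 3\<close> is its inverse and \<open>3 * m\<close> is 2 modulo
  \<open>p\<close>.\<close>

lemma mean_square_L_6:
  assumes m: "3 * m = int p + 2"
  shows "mean_square_L 6 p {1, a mod int p, (- 1 - a) mod int p}
     = 2 * pi\<^sup>2 / p * (25 / 18 * dedekind_sum3 a 1 p - 10 / 9 * dedekind_sum3 a 2 p - 5 / 6 * dedekind_sum3 a 3 p
         + 1 / 3 * (dedekind_sum3 a 6 p + dedekind_sum3 a m p))"
proof -
  let ?S = "\<lambda>c. \<Sum>\<psi>\<in>odd_chars. Re (\<psi> c) * (cmod (L_value \<psi>))\<^sup>2"
  have cong: "[3 * m = 2] (mod int p)" unfolding m by (simp add: cong_iff_mod_eq)
  then have "coprime (3 * m) (int p)" using coprime_p(1) cong_imp_coprime cong_sym by blast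
  then have copm: "coprime m (int p)" by simp
  have "(cmod (L_at_1 (induced_character (6 * p) \<psi>)))\<^sup>2
      = 25 / 18 * (Re (\<psi> 1) * (cmod (L_value \<psi>))\<^sup>2) - 10 / 9 * (Re (\<psi> 2) * (cmod (L_value \<psi>))\<^sup>2)
        - 5 / 6 * (Re (\<psi> 3) * (cmod (L_value \<psi>))\<^sup>2)
        + 1 / 3 * (Re (\<psi> 6) * (cmod (L_value \<psi>))\<^sup>2) + 1 / 3 * (Re (\<psi> m) * (cmod (L_value \<psi>))\<^sup>2)"
    if X: "\<psi> \<in> odd_chars" for \<psi>
  proof -
    have n2: "cmod (\<psi> 2) = 1" and n3: "cmod (\<psi> 3) = 1"
      using char_norm[OF X] coprime_p by auto
    have "\<psi> 2 = \<psi> 3 * \<psi> m"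
      using character_cong[OF p_gt_1 character[OF X] cong] char_mult[OF X, of 3 m] by simp
    then have "\<psi> 2 * cnj (\<psi> 3) = (\<psi> 3 * cnj (\<psi> 3)) * \<psi> m" by simp
    also have "\<psi> 3 * cnj (\<psi> 3) = 1" using n3 by (simp add: complex_norm_square[symmetric])
    finally have "Re (\<psi> m) = Re (\<psi> 2 * cnj (\<psi> 3))" by simp
    moreover have "\<psi> 6 = \<psi> 2 * \<psi> 3" using char_mult[OF X, of 2 3] by simp
    ultimately have prod: "Re (\<psi> 2) * Re (\<psi> 3) = (Re (\<psi> 6) + Re (\<psi> m)) / 2" by simp
    have "(cmod (L_at_1 (induced_character (6 * p) \<psi>)))\<^sup>2
        = (10 / 9 - 2 / 3 * Re (\<psi> 3)) * ((5 / 4 - Re (\<psi> 2)) * (cmod (L_value \<psi>))\<^sup>2)"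
      using cmod_Euler_factor[OF n2, of 2] cmod_Euler_factor[OF n3, of 3]
      by (simp add: L_induced_6[OF X] norm_mult power_mult_distrib)
    also have "\<dots> = (25 / 18 - 10 / 9 * Re (\<psi> 2) - 5 / 6 * Re (\<psi> 3) + 2 / 3 * (Re (\<psi> 2) * Re (\<psi> 3)))
        * (cmod (L_value \<psi>))\<^sup>2"
      by (simp add: algebra_simps)
    finally show ?thesis
      unfolding prod using character_1[OF p_gt_1 character[OF X]] by (simp add: algebra_simps)
  qed
  then have "(\<Sum>\<psi>\<in>odd_chars. (cmod (L_at_1 (induced_character (6 * p) \<psi>)))\<^sup>2)
      = 25 / 18 * ?S 1 - 10 / 9 * ?S 2 - 5 / 6 * ?S 3 + 1 / 3 * ?S 6 + 1 / 3 * ?S m"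
    by (simp add: sum.distrib sum_subtractf sum_distrib_left)
  also have "\<dots> = card odd_chars * (2 * pi\<^sup>2 / p * (25 / 18 * dedekind_sum3 a 1 p - 10 / 9 * dedekind_sum3 a 2 p
      - 5 / 6 * dedekind_sum3 a 3 p + 1 / 3 * (dedekind_sum3 a 6 p + dedekind_sum3 a m p)))"
    using sum_Re_chars_mean_square[of 1] sum_Re_chars_mean_square[OF coprime_p(1)]
      sum_Re_chars_mean_square[OF coprime_p(2)] sum_Re_chars_mean_square[OF coprime_p(3)]
      sum_Re_chars_mean_square[OF copm]
    by (simp add: algebra_simps)
  finally show ?thesis
    using odd_chars_orthogonality(1)[OF prime pn pa, folded odd_chars_def]
    by (simp add: mean_square_L_def odd_chars_def[symmetric])
qed

end

text \<open>By oddness the substitution merely exchanges the last two summands. It makes evaluations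
  at \<open>- 1 - a\<close> available when \<open>c\<close> divides that number instead of
  \<open>a\<close>.\<close>

lemma dedekind_sum3_flip: "dedekind_sum3 (- 1 - a) c p = dedekind_sum3 a c p"
proof -
  have "c * (- 1 - a) = - (c * (a + 1))" "c * (- 1 - a + 1) = - (c * a)" by (simp_all add: algebra_simps)
  then show ?thesis by (simp only: dedekind_sum3_def dedekind_sum_minus)
qed

text \<open>Evenness makes \<open>c = 2\<close> a divisor of \<open>a\<close>. The residue 4 modulo
  6 cannot occur, because 3 would divide \<open>p\<close>.\<close>

lemma mean_squares_even:
  fixes p :: nat and a :: int
  assumes "prime p" "p mod 6 = 1" and pa: "int p = a\<^sup>2 + a + 1" and "even a"
    and card3: "card {1, a mod int p, (- 1 - a) mod int p} = 3"
  shows "mean_square_L 2 p {1, a mod int p, (- 1 - a) mod int p}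
           = pi\<^sup>2 / 8 * (1 - of_int (2 * a + 1) / of_nat p)"
    and "mean_square_L 6 p {1, a mod int p, (- 1 - a) mod int p}
           = pi\<^sup>2 / 9 * (1 + of_int (c_coeff a) / of_nat p)"
    and "a mod 6 \<in> {0, 2}"
proof -
  define A where "A = real_of_int a"
  have p: "p = 6 * (p div 6) + 1" using assms(2) by presburger
  have p0: "p > 1" using assms(1) prime_gt_1_nat by auto
  have a: "a \<noteq> 0" "a \<noteq> - 1" using pa p0 by auto
  have P: "real p = A\<^sup>2 + A + 1"
    using arg_cong[OF pa, of real_of_int] by (simp add: A_def)
  have D1: "12 * dedekind_sum3 a 1 p = A * (A + 1)"
    using dedekind_sum3_multiple[of a a 1 "int p"] a pa by (simp add: A_def)
  have D2: "12 * dedekind_sum3 a 2 p = A * (A + 4) / 2"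
    using dedekind_sum3_multiple[of a "a div 2" 2 "int p"] a pa \<open>even a\<close> by (auto simp: A_def)
  have "mean_square_L 2 p {1, a mod int p, (- 1 - a) mod int p}
      = pi\<^sup>2 / (6 * p) * (5 / 4 * (12 * dedekind_sum3 a 1 p) - 12 * dedekind_sum3 a 2 p)"
    unfolding mean_square_L_2[OF assms(1) p pa card3] using p0 by (simp add: field_simps)
  also have "\<dots> = pi\<^sup>2 / 8 * ((A\<^sup>2 - A) / p)"
    unfolding D1 D2 using p0 by (simp add: field_simps power2_eq_square)
  also have "(A\<^sup>2 - A) / p = 1 - of_int (2 * a + 1) / of_nat p"
  proof -
    have "A\<^sup>2 - A = real p - of_int (2 * a + 1)" by (simp add: P A_def)
    then show ?thesis using p0 by (simp only: diff_divide_distrib) simp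
  qed
  finally show "mean_square_L 2 p {1, a mod int p, (- 1 - a) mod int p}
           = pi\<^sup>2 / 8 * (1 - of_int (2 * a + 1) / of_nat p)" .
  define m where "m = int (2 * (p div 6) + 1)"
  have m: "3 * m = int p + 2" using assms(2) unfolding m_def by presburger
  have M6: "mean_square_L 6 p {1, a mod int p, (- 1 - a) mod int p}
      = pi\<^sup>2 / (6 * p) * (25 / 18 * (12 * dedekind_sum3 a 1 p) - 10 / 9 * (12 * dedekind_sum3 a 2 p)
         - 5 / 6 * (12 * dedekind_sum3 a 3 p) + 1 / 3 * (12 * dedekind_sum3 a 6 p + 12 * dedekind_sum3 a m p))"
    unfolding mean_square_L_6[OF assms(1) p pa card3 m] using p0 by (simp add: field_simps)
  have "a mod 6 \<noteq> 4"
  proof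
    assume "a mod 6 = 4"
    then obtain b where "a = 6 * b + 4" by (metis mult_div_mod_eq)
    then have "int p = 6 * (6 * b\<^sup>2 + 9 * b + 3) + 3" unfolding pa by (simp add: power2_eq_square algebra_simps)
    with p show False by presburger
  qed
  then show amod: "a mod 6 \<in> {0, 2}" using \<open>even a\<close> by simp presburger
  \<comment> \<open>As \<open>p\<close> is \<open>A\<^sup>2 + A + 1\<close>, it remains to write the
    combination of Dedekind sums as 2/3 of p + C and to read off C.\<close>
  have fin: "pi\<^sup>2 / (6 * p) * (2 / 3 * (A\<^sup>2 + A + 1 + C)) = pi\<^sup>2 / 9 * (1 + C / of_nat p)" for C :: real
    unfolding P[symmetric] using p0 by (simp add: field_simps)
  from amod show "mean_square_L 6 p {1, a mod int p, (- 1 - a) mod int p}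
           = pi\<^sup>2 / 9 * (1 + of_int (c_coeff a) / of_nat p)"
  proof (elim insertE emptyE)
    assume a0: "a mod 6 = 0"
    define b where "b = a div 6"
    have ab: "a = 6 * b" using a0 unfolding b_def by presburger
    then have b: "b \<noteq> 0" using a by auto
    have D3: "12 * dedekind_sum3 a 3 p = A * (A + 9) / 3"
      using dedekind_sum3_multiple[of a "2 * b" 3 "int p"] a b pa ab by (simp add: A_def)
    have D6: "12 * dedekind_sum3 a 6 p = A * (A + 36) / 6"
      using dedekind_sum3_multiple[of a b 6 "int p"] a b pa ab by (simp add: A_def)
    have Dm: "12 * dedekind_sum3 a m p = A * (A / 6 + 2)"
      using dedekind_sum3_two_thirds_0[OF ab b pa m] by (simp add: A_def ab)
    have "mean_square_L 6 p {1, a mod int p, (- 1 - a) mod int p}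
        = pi\<^sup>2 / (6 * p) * (2 / 3 * (A\<^sup>2 + A + 1 + (- 2 * A - 1)))"
      unfolding M6 D1 D2 D3 D6 Dm using p0 by (simp add: field_simps power2_eq_square)
    then show ?thesis unfolding fin using a0 by (simp add: c_coeff_def A_def)
  next
    assume a2: "a mod 6 = 2"
    define b where "b = a div 6"
    have ab: "a = 6 * b + 2" using a2 unfolding b_def by presburger
    define B where "B = real_of_int b"
    have AB: "A = 6 * B + 2" by (simp add: A_def B_def ab)
    have pa': "int p = (- 1 - a)\<^sup>2 + (- 1 - a) + 1" unfolding pa by (simp add: power2_eq_square algebra_simps)
    have D3: "12 * dedekind_sum3 a 3 p = (- 1 - A) * (8 - A) / 3"
    proof -
      \<comment> \<open>For \<open>a\<close> equal to 2 modulo 6 it is \<open>- 1 - a\<close> that 3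
        divides, so \<open>c = 3\<close> is evaluated there and carried back by the flip.\<close>
      have "- 1 - a = (- 2 * b - 1) * 3" "- 2 * b - 1 \<noteq> 0" using ab by presburger+
      from dedekind_sum3_multiple[OF this(1) _ this(2) _ pa'] a show ?thesis
        by (simp add: A_def dedekind_sum3_flip)
    qed
    note D6m = dedekind_sum3_two_thirds_2[OF ab pa m, folded B_def]
    have "mean_square_L 6 p {1, a mod int p, (- 1 - a) mod int p}
        = pi\<^sup>2 / (6 * p) * (2 / 3 * (A\<^sup>2 + A + 1 + (- 3)))"
      unfolding M6 D1 D2 D3 D6m using p0 by (simp add: AB field_simps power2_eq_square)
    then show ?thesis unfolding fin using a2 by (simp add: c_coeff_def A_def)
  qed
qed

theorem theorem6p5:
  fixes p :: nat and a :: int and H :: "int set"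
  assumes "prime p"
    and "[p = 1] (mod 6)"
    and "int p = a\<^sup>2 + a + 1"
    and "subgroup H (units_of (residue_ring (int p)))"
    and "card H = 3"
  shows "mean_square_L 2 p H
           = pi\<^sup>2 / 8 * (1 - (- 1) powi a * (of_int (2 * a + 1) / of_nat p))
       \<and> mean_square_L 6 p H
           = pi\<^sup>2 / 9 * (1 + of_int (c_coeff a) / of_nat p)
       \<and> a mod 6 \<in> {0, 2, 3, 5}"
proof -
  have p6: "p mod 6 = 1" using assms(2) by (simp add: cong_iff_mod_eq)
  have H: "H = {1, a mod int p, (- 1 - a) mod int p}"
    using subgroup_order_3_eq[OF assms(1,3-5)] .
  show ?thesis
  proof (cases "even a")
    case True
    then show ?thesis
      using mean_squares_even[OF assms(1) p6 assms(3)] assms(5) by (auto simp: H)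
  next
    case False
    define a' where "a' = - 1 - a"
    have a: "a = - 1 - a'" by (simp add: a'_def)
    have pa': "int p = a'\<^sup>2 + a' + 1" unfolding assms(3) by (simp add: a'_def power2_eq_square algebra_simps)
    \<comment> \<open>The substitution swaps the two nontrivial elements of
      \<open>H\<close>.\<close>
    have H': "H = {1, a' mod int p, (- 1 - a') mod int p}" unfolding H a'_def by auto
    have "even a'" using False by (simp add: a'_def)
    note main = mean_squares_even[OF assms(1) p6 pa' this assms(5)[unfolded H'], folded H']
    \<comment> \<open>Residues 5 and 3 of \<open>a\<close> correspond to 0 and 2 of
      \<open>a'\<close>. Since 2a + 1 = -2a' - 1, the coefficients agree.\<close>
    have amod: "a mod 6 = 5 \<and> a' mod 6 = 0 \<or> a mod 6 = 3 \<and> a' mod 6 = 2"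
      using main(3) unfolding a by simp presburger
    then have c: "c_coeff a' = c_coeff a"
      by (elim disjE) (simp_all add: c_coeff_def a'_def)
    \<comment> \<open>For odd \<open>a\<close> the factor -1 cancels the sign in 2a + 1 = -(2a' +
      1).\<close>
    have "(- 1) powi a * (of_int (2 * a + 1) / of_nat p) = (of_int (2 * a' + 1) / of_nat p :: real)"
      using False by (simp add: a'_def power_int_minus_left field_simps)
    with main(1,2) amod c show ?thesis by auto
  qed
qed

end
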